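(* Let $1/2\leq\alpha<\beta$ and let $f$ be holomorphic in $\{z\in\mathbb{C}: \alpha<\Re z<\beta\}\setminus\{1\}$ with continuous extension to the lines $\Re z=\alpha$ and $\Re z=\beta$, such that: (1) if $\beta>1$, then $f$ has a pole of order $m\geq0$ at $z=1$; if $\beta\leq1$, set $m=0$; (2) for every fixed $d>0$, $\lim_{|y|\to\infty, y\in\mathbb{R}}e^{-dy^2}|f(x+iy)|=0$ uniformly in $x\in[\alpha,\beta]$; (3) for $x\in\{\alpha,\beta\}$ and every fixed $a\geq0$, $b>0$, $c>0$, $\lim_{|u|\to\infty,u\in\mathbb{R}}e^{-u^2}I_f(x,a,bu,c)=0$. Let $T>H\geq0$, $\kappa>0$, $A_1\geq0$, $A_2\geq0$, and let $\lambda,\mu>0$ be arbitrary. Then for every $x\in[\alpha,\beta]$ (with $H>0$ required if $x=1$ and $m\neq0$), \begin{multline*} \left(I_{f}\left(x,-T,-H,w_{1}\lambda+w_{2}\mu\right)+I_{f}\left(x,H,T,w_{1}\lambda+w_{2}\mu\right)\right)^{w_{1}\lambda+w_{2}\mu} \leq \left(\frac{(x-1)^2+H^2}{x^2+H^2}\right)^{-\frac{m}{2}}\\ \times\exp{\left(\kappa\left(1+\left(\frac{\beta-\alpha}{2T}\right)^{2}\right)\right)}\left(\mathcal{J}(\alpha,A_1,\lambda)\right)^{w_1\lambda}\left(\mathcal{J}(\beta,A_2,\mu)\right)^{w_2\mu}, \end{multline*} where $w_1=\frac{\beta-x}{\beta-\alpha}$, $w_2=\frac{x-\alpha}{\beta-\alpha}$,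 and \[ \mathcal{J}(a,b,c) = I_{f}(a,-b,b,c)+\int_{\frac{\kappa}{c}\left(\frac{b}{T}\right)^2}^{\infty}e^{-u}\left(I_{f}\left(a,-T\sqrt{\tfrac{cu}{\kappa}},-b,c\right)+I_{f}\left(a,b,T\sqrt{\tfrac{cu}{\kappa}},c\right)\right)du. \]
   Context: For a function $f$ such that $y\mapsto f(x+iy)$ is continuous on the relevant range, real numbers $A,B$ and $c>0$, define $I_f(x,A,B,c)=\int_A^B|f(x+iy)|^{1/c}\,dy$ (an oriented integral, so it is nonpositive when $B<A$). *)

theory Defs
  imports "HOL-Complex_Analysis.Complex_Analysis"
begin

text \<open>
  Real power with the usual convention \<open>0\<^sup>0 = 1\<close>. The library function \<^const>\<open>powr\<close> has
  \<open>0 powr 0 = 0\<close>, which would be wrong for the vanishing exponents \<open>w\<^sub>1 \<lambda>\<close>, \<open>w\<^sub>2 \<mu>\<close> at the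
  end points of \<open>[\<alpha>, \<beta>]\<close> and for \<open>m = 0\<close>, \<open>x = 1\<close>, \<open>H = 0\<close>.
\<close>

definition rpow :: "real \<Rightarrow> real \<Rightarrow> real"  (infixr "rpow" 80)
  where "x rpow a = (if a = 0 then 1 else x powr a)"

text \<open>
  \<open>f\<close>, given on the domain \<open>S\<close>, has a pole of order \<open>m \<ge> 0\<close> at \<open>z\<close>. A pole of order \<open>0\<close> means
  that \<open>z\<close> is no singularity; a zero at \<open>z\<close> is allowed, so this case is not \<open>zorder f z = 0\<close>.
  It is expressed by a finite limit along \<open>S\<close>, which for open \<open>S\<close> containing \<open>z\<close> and \<open>f\<close>
  holomorphic on \<open>S - {z}\<close> says that the singularity is removable, and which does not involve
  the irrelevant values of the total function \<open>f\<close> outside \<open>S\<close>.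
\<close>

definition has_pole_of_order :: "(complex \<Rightarrow> complex) \<Rightarrow> complex set \<Rightarrow> complex \<Rightarrow> nat \<Rightarrow> bool"
  where "has_pole_of_order f S z m \<longleftrightarrow>
    (if m = 0 then \<exists>l. (f \<longlongrightarrow> l) (at z within S)
     else isolated_singularity_at f z \<and> is_pole f z \<and> zorder f z = - int m)"

text \<open>The interval integral \<open>LBINT y=A..B\<close> is oriented, as required.\<close>

definition I_int :: "(complex \<Rightarrow> complex) \<Rightarrow> real \<Rightarrow> real \<Rightarrow> real \<Rightarrow> real \<Rightarrow> real"
  where "I_int f x A B c = (LBINT y=ereal A..ereal B. norm (f (Complex x y)) powr (1 / c))"

definition J_int :: "(complex \<Rightarrow> complex) \<Rightarrow> real \<Rightarrow> real \<Rightarrow> real \<Rightarrow> real \<Rightarrow> real \<Rightarrow> real"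
  where "J_int f T \<kappa> a b c =
    I_int f a (- b) b c +
    (LBINT u=ereal (\<kappa> / c * (b / T)\<^sup>2)..\<infinity>.
       exp (- u) * (I_int f a (- (T * sqrt (c * u / \<kappa>))) (- b) c +
                    I_int f a b (T * sqrt (c * u / \<kappa>)) c))"

end

theory Submission
  imports Defs "HOL-Real_Asymp.Real_Asymp"
begin

text \<open>
  Put \<open>F z = f z * ((z - 1) / z) ^ m * exp (\<kappa> * (z - (\<alpha> + \<beta>) / 2)\<^sup>2 / T\<^sup>2)\<close>, which has no pole and
  tends to \<open>0\<close> uniformly in the closed strip. On the line \<open>Re z = x\<close> the heart of the matter is
  Gabriel's convexity theorem: the logarithm of the \<open>L\<close>-norm of \<open>F\<close> with exponent \<open>1 / c\<close> on
  vertical lines is convex when \<open>c\<close> varies linearly with \<open>x\<close>. After replacing the integral by a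
  Riemann sum of vertical translates \<open>F\<^sub>j\<close> of \<open>F\<close>, this is a three lines theorem for the sums
  of \<open>\<bar>F\<^sub>j\<bar> powr (1 / c)\<close>. Duality turns it into the maximum principle for sums of
  \<open>\<bar>h\<^sub>j\<bar> powr r\<close> with one fixed exponent \<open>r\<close> and \<open>h\<^sub>j = F\<^sub>j * exp (linear function)\<close>.
  This also covers exponents \<open>1 / c < 1\<close>, since \<open>h\<^sub>j\<close> has holomorphic powers off its zeros.

  On the boundary lines \<open>\<bar>(z - 1) / z\<bar> \<le> 1\<close>, and integrating the Gaussian weight by parts
  produces the tail integral in \<open>J_int\<close>. On the line \<open>Re z = x\<close>, for \<open>H < \<bar>y\<bar> < T\<close>, the
  two factors are bounded below by their values at \<open>\<bar>y\<bar> = H\<close> and by \<open>exp (- \<kappa>)\<close>.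
\<close>

section \<open>Sums of powers of moduli of holomorphic functions\<close>

text \<open>Functions that do not vanish at \<open>z0\<close> have holomorphic powers on a small
  ball; the other terms are nonnegative, and 0 at \<open>z0\<close>. For a suitable sum
  \<open>k\<close> of such powers, the modulus of \<open>k z\<close> is at most the sum at
  \<open>z\<close>, hence at most the sum at \<open>z0\<close>, which is the modulus of
  \<open>k z0\<close>. The maximum modulus principle makes \<open>k\<close> constant, so all these
  inequalities are equalities.\<close>

lemma sum_norm_powr_const_near_local_max:
  fixes h :: "'i \<Rightarrow> complex \<Rightarrow> complex" and r :: real
  assumes J: "finite J" and e: "e > 0"
    and hol: "\<And>j. j \<in> J \<Longrightarrow> h j holomorphic_on ball z0 e"
    and max: "\<And>z. z \<in> ball z0 e \<Longrightarrow> (\<Sum>j\<in>J. norm (h j z) powr r) \<le> (\<Sum>j\<in>J. norm (h j z0) powr r)"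
  shows "\<exists>d>0. d \<le> e \<and>
    (\<forall>z\<in>ball z0 d. (\<Sum>j\<in>J. norm (h j z) powr r) = (\<Sum>j\<in>J. norm (h j z0) powr r))"
proof -
  define K where "K = {j\<in>J. h j z0 \<noteq> 0}"
  have K: "finite K" "K \<subseteq> J" using J by (auto simp: K_def)
  have "\<exists>d>0. d \<le> e \<and> (\<forall>z\<in>ball z0 d. h j z \<noteq> 0)" if "j \<in> K" for j
  proof -
    have "isCont (h j) z0"
      using holomorphic_on_imp_continuous_on[OF hol[of j]] that K e
      by (intro continuous_on_interior[of "ball z0 e"]) auto
    then have "\<exists>d>0. \<forall>z. dist z0 z < d \<longrightarrow> h j z \<noteq> 0"
      using that by (intro continuous_at_avoid) (auto simp: K_def)
    then obtain d where "d > 0" "\<forall>z. dist z0 z < d \<longrightarrow> h j z \<noteq> 0"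
      by (elim exE conjE)
    then show ?thesis using e by (intro exI[of _ "min d e"]) auto
  qed
  then obtain D where D: "\<And>j. j \<in> K \<Longrightarrow> D j > 0 \<and> D j \<le> e \<and> (\<forall>z\<in>ball z0 (D j). h j z \<noteq> 0)"
    by metis
  define d where "d = Min (insert e (D ` K))"
  have d: "d > 0" "d \<le> e" "\<And>j. j \<in> K \<Longrightarrow> d \<le> D j"
    using D K e by (auto simp: d_def)
  have ball: "ball z0 d \<subseteq> ball z0 e" using d by auto
  have "\<exists>l. l holomorphic_on ball z0 d \<and> (\<forall>z\<in>ball z0 d. exp (l z) = h j z)" if "j \<in> K" for j
  proof (rule holomorphic_logarithm_exists[of "ball z0 d" "h j" z0])
    show "h j holomorphic_on ball z0 d"
      using hol[of j] that K ball by (meson holomorphic_on_subset in_mono)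
    show "h j z \<noteq> 0" if "z \<in> ball z0 d" for z
      using D[OF \<open>j \<in> K\<close>] d(3)[OF \<open>j \<in> K\<close>] that by auto
  qed (use d in auto)
  then obtain l where l: "\<And>j. j \<in> K \<Longrightarrow> l j holomorphic_on ball z0 d"
      "\<And>j z. j \<in> K \<Longrightarrow> z \<in> ball z0 d \<Longrightarrow> exp (l j z) = h j z"
    by metis
  \<comment> \<open>The branches of the powers are rotated so as to be positive at \<open>z0\<close>, so that \<open>\<bar>k\<bar>\<close> is dominated
    by the sum, with equality at \<open>z0\<close>.\<close>
  define k where "k = (\<lambda>z. \<Sum>j\<in>K. exp (of_real r * (l j z - \<i> * of_real (Im (l j z0)))))"
  have normexp: "norm (exp (of_real r * (l j z - \<i> * of_real (Im (l j z0))))) = norm (h j z) powr r"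
    if "j \<in> K" "z \<in> ball z0 d" for j z
    by (simp add: l(2)[OF that, symmetric] powr_def)
  have le: "norm (k z) \<le> (\<Sum>j\<in>J. norm (h j z) powr r)" if "z \<in> ball z0 d" for z
  proof -
    have "norm (k z) \<le> (\<Sum>j\<in>K. norm (h j z) powr r)"
      unfolding k_def using normexp that by (intro sum_norm_le) auto
    also have "\<dots> \<le> (\<Sum>j\<in>J. norm (h j z) powr r)"
      using J K by (intro sum_mono2) auto
    finally show ?thesis .
  qed
  have z0: "z0 \<in> ball z0 d" using d by simp
  have "k z0 = (\<Sum>j\<in>K. of_real (norm (h j z0) powr r))"
    unfolding k_def
  proof (rule sum.cong[OF refl])
    fix j assume j: "j \<in> K"
    have "l j z0 - \<i> * of_real (Im (l j z0)) = of_real (Re (l j z0))"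
      by (simp add: complex_eq_iff)
    then show "exp (of_real r * (l j z0 - \<i> * of_real (Im (l j z0)))) = of_real (norm (h j z0) powr r)"
      by (simp add: l(2)[OF j z0, symmetric] powr_def exp_of_real[symmetric] mult.commute)
  qed
  then have "norm (k z0) = (\<Sum>j\<in>K. norm (h j z0) powr r)"
    by (simp add: sum_nonneg flip: of_real_sum)
  \<comment> \<open>Indices outside \<open>K\<close> contribute \<open>0 powr r\<close>, which is 0
    for every real \<open>r\<close>.\<close>
  also have "\<dots> = (\<Sum>j\<in>J. norm (h j z0) powr r)"
    using J by (intro sum.mono_neutral_left) (auto simp: K_def)
  finally have eq: "norm (k z0) = (\<Sum>j\<in>J. norm (h j z0) powr r)" .
  have "k constant_on ball z0 d"
  proof (rule maximum_modulus_principle[of k "ball z0 d" "ball z0 d" z0])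
    show "k holomorphic_on ball z0 d"
      unfolding k_def by (intro holomorphic_intros l)
    show "norm (k z) \<le> norm (k z0)" if "z \<in> ball z0 d" for z
      using le[OF that] max[of z] that ball eq by auto
  qed (use d in auto)
  then have const: "k z = k z0" if "z \<in> ball z0 d" for z
    using that z0 unfolding constant_on_def by metis
  show ?thesis
  proof (intro exI conjI ballI)
    show "d > 0" "d \<le> e" by (fact d)+
    fix z assume z: "z \<in> ball z0 d"
    show "(\<Sum>j\<in>J. norm (h j z) powr r) = (\<Sum>j\<in>J. norm (h j z0) powr r)"
      using le[OF z] max[of z] const[OF z] eq z ball by (intro antisym) auto
  qed
qed

text \<open>By the decay at infinity, a value above \<open>M\<close> forces the sum to attain its
  maximum over the closed strip. The boundary bound excludes the two lines, and local constancy near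
  an interior maximum excludes the rest.\<close>

lemma strip_maximum_principle_sum_norm_powr:
  fixes h :: "'i \<Rightarrow> complex \<Rightarrow> complex" and r \<alpha> \<beta> M :: real
  assumes J: "finite J" and r: "r > 0" and ab: "\<alpha> < \<beta>"
    and hol: "\<And>j. j \<in> J \<Longrightarrow> h j holomorphic_on {z. \<alpha> < Re z \<and> Re z < \<beta>}"
    and cont: "\<And>j. j \<in> J \<Longrightarrow> continuous_on {z. \<alpha> \<le> Re z \<and> Re z \<le> \<beta>} (h j)"
    and lim: "\<And>j. j \<in> J \<Longrightarrow>
      (h j \<longlongrightarrow> 0) (inf at_infinity (principal {z. \<alpha> \<le> Re z \<and> Re z \<le> \<beta>}))"
    and bd: "\<And>z. Re z = \<alpha> \<or> Re z = \<beta> \<Longrightarrow> (\<Sum>j\<in>J. norm (h j z) powr r) \<le> M"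
    and z: "\<alpha> \<le> Re z" "Re z \<le> \<beta>"
  shows "(\<Sum>j\<in>J. norm (h j z) powr r) \<le> M"
proof (rule ccontr)
  define P where "P = (\<lambda>z. \<Sum>j\<in>J. norm (h j z) powr r)"
  define C where "C = {z. \<alpha> \<le> Re z \<and> Re z \<le> \<beta>}"
  assume "\<not> ?thesis"
  then have zM: "P z > M" by (simp add: P_def)
  \<comment> \<open>\<open>M\<close> is nonnegative because it bounds the sum on the left line.
    Hence \<open>P z > 0\<close>, so the decay pushes \<open>P\<close> below \<open>P z\<close>
    outside a compact set.\<close>
  have "0 \<le> P (of_real \<alpha>)" by (simp add: P_def sum_nonneg)
  also have "\<dots> \<le> M" unfolding P_def by (rule bd) simp
  finally have "P z > 0" using zM by simp
  have contP: "continuous_on C P"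
    unfolding P_def C_def using r by (intro continuous_intros continuous_on_powr' cont) auto
  have "(P \<longlongrightarrow> (\<Sum>j\<in>J. norm (0::complex) powr r)) (inf at_infinity (principal C))"
    unfolding P_def C_def using r by (intro tendsto_intros tendsto_powr' lim) auto
  then have "(P \<longlongrightarrow> 0) (inf at_infinity (principal C))" by simp
  then have "\<forall>\<^sub>F w in inf at_infinity (principal C). P w < P z"
    using \<open>P z > 0\<close> by (rule order_tendstoD)
  then obtain b where b: "\<And>w. b \<le> norm w \<Longrightarrow> w \<in> C \<Longrightarrow> P w < P z"
    by (auto simp: eventually_inf_principal eventually_at_infinity)
  define K where "K = cball 0 b \<inter> C"
  have "C = {z. \<alpha> \<le> Re z} \<inter> {z. Re z \<le> \<beta>}" by (auto simp: C_def)
  then have "closed C" by (simp add: closed_halfspace_Re_ge closed_halfspace_Re_le closed_Int)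
  then have K: "compact K" unfolding K_def by (intro compact_Int_closed) auto
  have contK: "continuous_on K P" using contP by (rule continuous_on_subset) (auto simp: K_def)
  have inK: "w \<in> K" if "w \<in> C" "P w \<ge> P z" for w
    using b[of w] that by (force simp: K_def)
  have zC: "z \<in> C" using z by (simp add: C_def)
  \<comment> \<open>A maximum point with least real part cannot be interior: the sum is constant near it.\<close>
  obtain z1 where z1: "z1 \<in> K" "\<And>w. w \<in> K \<Longrightarrow> P w \<le> P z1"
    using continuous_attains_sup[OF K _ contK] inK[OF zC] by auto
  define E where "E = K \<inter> P -` {P z1}"
  have "closed E" unfolding E_def
    using contK compact_imp_closed[OF K] by (rule continuous_closed_preimage) simp
  then have "compact E"
    using compact_Int_closed[OF K, of E] by (simp add: E_def flip: Int_assoc)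
  moreover have "E \<noteq> {}" using z1 by (auto simp: E_def)
  ultimately have "\<exists>z2\<in>E. \<forall>w\<in>E. Re z2 \<le> Re w"
    by (intro continuous_attains_inf continuous_intros)
  then obtain z2 where z2: "z2 \<in> E" "\<And>w. w \<in> E \<Longrightarrow> Re z2 \<le> Re w"
    by metis
  have Pz2: "P z2 = P z1" "z2 \<in> C" "P z1 \<ge> P z"
    using z2 z1 inK[OF zC] by (auto simp: E_def K_def)
  have Pmax: "P w \<le> P z2" if "w \<in> C" for w
    using inK[OF that] z1(2)[of w] Pz2 by force
  have "Re z2 \<noteq> \<alpha>" "Re z2 \<noteq> \<beta>"
    using bd[of z2] Pz2 zM by (auto simp: P_def)
  then have "z2 \<in> {z. \<alpha> < Re z \<and> Re z < \<beta>}" using Pz2 by (auto simp: C_def)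
  moreover have "{z. \<alpha> < Re z \<and> Re z < \<beta>} = {z. \<alpha> < Re z} \<inter> {z. Re z < \<beta>}" by auto
  then have "open {z. \<alpha> < Re z \<and> Re z < \<beta>}"
    by (simp add: open_halfspace_Re_gt open_halfspace_Re_lt open_Int)
  ultimately obtain e where e: "e > 0" "ball z2 e \<subseteq> {z. \<alpha> < Re z \<and> Re z < \<beta>}"
    using open_contains_ball by meson
  have holb: "h j holomorphic_on ball z2 e" if "j \<in> J" for j
    using hol[OF that] e(2) by (rule holomorphic_on_subset)
  have maxb: "(\<Sum>j\<in>J. norm (h j w) powr r) \<le> (\<Sum>j\<in>J. norm (h j z2) powr r)" if "w \<in> ball z2 e" for w
  proof -
    have "w \<in> C" using that e(2) by (auto simp: C_def)
    from Pmax[OF this] show ?thesis by (simp add: P_def)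
  qed
  obtain d where d: "0 < d" "d \<le> e" "\<And>w. w \<in> ball z2 d \<Longrightarrow> P w = P z2"
    using sum_norm_powr_const_near_local_max[OF J e(1) holb maxb] unfolding P_def by metis
  \<comment> \<open>Half the radius to the left: \<open>w\<close> stays in the ball, is again a
    maximum point, and has smaller real part than \<open>z2\<close>.\<close>
  define w where "w = z2 - of_real (d/2)"
  have "dist z2 w = d / 2" using d(1) by (simp only: w_def dist_norm) simp
  then have wd: "w \<in> ball z2 d" using d(1) by simp
  with d(2) have "w \<in> ball z2 e" by simp
  with e(2) have "w \<in> C" by (auto simp: C_def)
  moreover have "P w = P z2" by (rule d(3)[OF wd])
  ultimately have "w \<in> E" using inK[of w] Pz2 by (simp add: E_def)
  from z2(2)[OF this] show False using d(1) by (simp add: w_def)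
qed

text \<open>Young's inequality for the numbers \<open>b powr (1 / p) / M\<close> and
  \<open>a\<close> with weights \<open>p / (p + q)\<close> and \<open>q / (p + q)\<close>. The left
  side is the form that the summands take on the boundary lines in the three lines theorem
  below.\<close>

lemma young_powr:
  fixes a b M p q :: real
  assumes "p > 0" "q > 0" "a > 0" "b \<ge> 0" "M > 0"
  shows "(b * exp (q * ln a - p * ln M)) powr (1 / (p + q))
    \<le> p / (p + q) * (b powr (1 / p) / M) + q / (p + q) * a"
proof (cases "b = 0")
  case True
  then show ?thesis using assms by simp
next
  case False
  then have b: "b > 0" using assms by simp
  have "(b * exp (q * ln a - p * ln M)) powr (1 / (p + q))
      = (b powr (1 / p) / M) powr (p / (p + q)) * a powr (q / (p + q))"
  proof -
    have "1 / (p + q) * (ln b + (q * ln a - p * ln M))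
      = p / (p + q) * (1 / p * ln b - ln M) + q / (p + q) * ln a"
      using assms by (simp add: right_diff_distrib add_divide_distrib diff_divide_distrib distrib_left)
    then show ?thesis using b assms
      by (simp add: powr_def ln_mult ln_div flip: exp_add)
  qed
  also have "\<dots> \<le> p / (p + q) * (b powr (1 / p) / M) + q / (p + q) * a"
    using b assms by (intro Youngs_inequality_0) (auto simp flip: add_divide_distrib)
  finally show ?thesis .
qed

text \<open>Duality with weights \<open>a j\<close> of sum 1 replaces the exponent that varies with
  \<open>Re z\<close> by the single exponent \<open>1 / (lam + \<mu>)\<close>. An exponential factor
  in \<open>h j\<close> carries the weights and the bounds \<open>M0\<close>, \<open>M1\<close>.
  Young's inequality bounds the resulting sum by 1 on both lines, and the maximum principle carries
  this to \<open>z0\<close>, where it becomes the claim.\<close>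

lemma three_lines_sum_norm_powr:
  fixes F :: "'i \<Rightarrow> complex \<Rightarrow> complex" and \<alpha> \<beta> lam \<mu> M0 M1 :: real
  assumes J: "finite J" and ab: "\<alpha> < \<beta>" and lam: "lam > 0" and mu: "\<mu> > 0"
    and hol: "\<And>j. j \<in> J \<Longrightarrow> F j holomorphic_on {z. \<alpha> < Re z \<and> Re z < \<beta>}"
    and cont: "\<And>j. j \<in> J \<Longrightarrow> continuous_on {z. \<alpha> \<le> Re z \<and> Re z \<le> \<beta>} (F j)"
    and lim: "\<And>j. j \<in> J \<Longrightarrow>
      (F j \<longlongrightarrow> 0) (inf at_infinity (principal {z. \<alpha> \<le> Re z \<and> Re z \<le> \<beta>}))"
    and M: "M0 > 0" "M1 > 0"
    and bd0: "\<And>z. Re z = \<alpha> \<Longrightarrow> (\<Sum>j\<in>J. norm (F j z) powr (1 / lam)) \<le> M0"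
    and bd1: "\<And>z. Re z = \<beta> \<Longrightarrow> (\<Sum>j\<in>J. norm (F j z) powr (1 / \<mu>)) \<le> M1"
    and z: "\<alpha> \<le> Re z0" "Re z0 \<le> \<beta>"
    and w: "w\<^sub>1 = (\<beta> - Re z0) / (\<beta> - \<alpha>)" "w\<^sub>2 = (Re z0 - \<alpha>) / (\<beta> - \<alpha>)"
    and c: "c = w\<^sub>1 * lam + w\<^sub>2 * \<mu>"
  shows "(\<Sum>j\<in>J. norm (F j z0) powr (1 / c)) powr c \<le> M0 powr (w\<^sub>1 * lam) * M1 powr (w\<^sub>2 * \<mu>)"
proof -
  define S where "S = (\<Sum>j\<in>J. norm (F j z0) powr (1 / c))"
  \<comment> \<open>Terms with \<open>F j z0 = 0\<close> do not contribute at \<open>z0\<close>;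
    leaving them out makes the weights positive, so that their logarithms are meaningful.\<close>
  define K where "K = {j\<in>J. F j z0 \<noteq> 0}"
  have K: "finite K" "K \<subseteq> J" using J by (auto simp: K_def)
  have wn: "w\<^sub>1 \<ge> 0" "w\<^sub>2 \<ge> 0" "w\<^sub>1 + w\<^sub>2 = 1"
    using w z ab by (auto simp flip: add_divide_distrib)
  have cpos: "c > 0"
    using wn lam mu unfolding c by (metis add_nonneg_pos add_pos_nonneg less_eq_real_def
        mult_nonneg_nonneg mult_pos_pos add.right_neutral zero_neq_one)
  have SK: "S = (\<Sum>j\<in>K. norm (F j z0) powr (1 / c))"
    unfolding S_def using J by (intro sum.mono_neutral_right) (auto simp: K_def)
  show ?thesis
  proof (cases "K = {}")
    case True
    then show ?thesis using SK by (simp flip: S_def)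
  next
    case False
    have S: "S > 0" unfolding SK using K False by (intro sum_pos) (auto simp: K_def)
    \<comment> \<open>The weights \<open>a j\<close> give equality in Hoelder's inequality at \<open>z0\<close>.\<close>
    define a where "a = (\<lambda>j. norm (F j z0) powr (1 / c) / S)"
    have a: "a j > 0" if "j \<in> K" for j using that S by (simp add: a_def K_def)
    have suma: "(\<Sum>j\<in>K. a j) = 1"
      using S by (simp add: a_def SK flip: sum_divide_distrib)
    define W where "W = (\<lambda>z::complex. (z - of_real \<alpha>) / of_real (\<beta> - \<alpha>))"
    \<comment> \<open>\<open>G j\<close> is affine in \<open>z\<close>. Its real part is
      \<open>\<mu> * ln (a j) - lam * ln M0\<close> on the left line and
      \<open>lam * ln (a j) - \<mu> * ln M1\<close> on the right line, as \<open>young_powr\<close>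
      requires.\<close>
    define G where "G = (\<lambda>j z. of_real (lam + \<mu>) * of_real (ln (a j))
       - of_real lam * (1 - W z) * of_real (ln (a j) + ln M0) - of_real \<mu> * W z * of_real (ln (a j) + ln M1))"
    define h where "h = (\<lambda>j z. F j z * exp (G j z))"
    have ReW: "Re (W z) = (Re z - \<alpha>) / (\<beta> - \<alpha>)" for z
      by (simp add: W_def Re_divide_of_real flip: of_real_diff)
    have ReG: "Re (G j z) = (lam + \<mu>) * ln (a j) - lam * (1 - Re (W z)) * (ln (a j) + ln M0)
       - \<mu> * Re (W z) * (ln (a j) + ln M1)" for j z
      by (simp add: G_def algebra_simps)
    have Whol: "W holomorphic_on A" for A unfolding W_def by (intro holomorphic_intros) (use ab in auto)
    have Ghol: "G j holomorphic_on A" for j A unfolding G_def by (intro holomorphic_intros Whol)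
    have normh: "norm (h j z) = norm (F j z) * exp (Re (G j z))" for j z
      by (simp add: h_def norm_mult)
    have main: "(\<Sum>j\<in>K. norm (h j z0) powr (1 / (lam + \<mu>))) \<le> 1"
    proof (rule strip_maximum_principle_sum_norm_powr[OF K(1) _ ab _ _ _ _ z])
      show "h j holomorphic_on {z. \<alpha> < Re z \<and> Re z < \<beta>}" if "j \<in> K" for j
        unfolding h_def using that K by (intro holomorphic_intros Ghol hol) auto
      show "continuous_on {z. \<alpha> \<le> Re z \<and> Re z \<le> \<beta>} (h j)" if "j \<in> K" for j
        unfolding h_def using that K
        by (intro continuous_intros holomorphic_on_imp_continuous_on[OF Ghol] cont) auto
      show "(h j \<longlongrightarrow> 0) (inf at_infinity (principal {z. \<alpha> \<le> Re z \<and> Re z \<le> \<beta>}))" if "j \<in> K" for j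
        unfolding h_def
      proof (rule lim_null_mult_right_bounded)
        \<comment> \<open>\<open>Re (G j z)\<close> depends only on the relative position of
          \<open>Re z\<close> in the strip, a number in [0, 1]; \<open>B\<close> replaces each term
          by its largest possible absolute value.\<close>
        define B where "B = (lam + \<mu>) * \<bar>ln (a j)\<bar> + lam * \<bar>ln (a j) + ln M0\<bar> + \<mu> * \<bar>ln (a j) + ln M1\<bar>"
        show "(F j \<longlongrightarrow> 0) (inf at_infinity (principal {z. \<alpha> \<le> Re z \<and> Re z \<le> \<beta>}))"
          using that K lim by auto
        have "norm (exp (G j z)) \<le> exp B" if "\<alpha> \<le> Re z" "Re z \<le> \<beta>" for z
        proof -
          define t where "t = Re (W z)"
          have t: "0 \<le> t" "t \<le> 1" using that ab by (auto simp: t_def ReW)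
          have le: "- (s * x) \<le> \<bar>x\<bar>" if "0 \<le> s" "s \<le> 1" for s x :: real
            using mult_left_le_one_le[of "\<bar>x\<bar>" s] that abs_ge_minus_self[of "s * x"]
            by (simp add: abs_mult)
          then have "- (lam * ((1 - t) * (ln (a j) + ln M0))) \<le> lam * \<bar>ln (a j) + ln M0\<bar>"
            "- (\<mu> * (t * (ln (a j) + ln M1))) \<le> \<mu> * \<bar>ln (a j) + ln M1\<bar>"
            using mult_left_mono[OF le[of "1 - t" "ln (a j) + ln M0"], of lam]
              mult_left_mono[OF le[of t "ln (a j) + ln M1"], of \<mu>] t lam mu by auto
          moreover have "(lam + \<mu>) * ln (a j) \<le> (lam + \<mu>) * \<bar>ln (a j)\<bar>"
            using lam mu by (intro mult_left_mono) auto
          ultimately show ?thesis unfolding norm_exp_eq_Re ReG exp_le_cancel_iff B_def t_def[symmetric]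
            by (simp add: mult.assoc)
        qed
        then show "\<forall>\<^sub>F z in inf at_infinity (principal {z. \<alpha> \<le> Re z \<and> Re z \<le> \<beta>}). norm (exp (G j z)) \<le> exp B"
          by (simp add: eventually_inf_principal)
      qed
      \<comment> \<open>Used with \<open>p = lam\<close>, \<open>q = \<mu>\<close> on the left line
        and with the roles exchanged on the right line.\<close>
      have young: "(\<Sum>j\<in>K. (norm (F j z) * exp (q * ln (a j) - p * ln M)) powr (1 / (p + q))) \<le> 1"
        if "(\<Sum>j\<in>J. norm (F j z) powr (1 / p)) \<le> M" "p > 0" "q > 0" "M > 0" for p q M z
      proof -
        have "(\<Sum>j\<in>K. (norm (F j z) * exp (q * ln (a j) - p * ln M)) powr (1 / (p + q)))
          \<le> (\<Sum>j\<in>K. p / (p + q) * (norm (F j z) powr (1 / p) / M) + q / (p + q) * a j)"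
          using that a by (intro sum_mono young_powr) auto
        also have "\<dots> = p / (p + q) * ((\<Sum>j\<in>K. norm (F j z) powr (1 / p)) / M) + q / (p + q)"
          using suma by (simp add: sum.distrib flip: sum_distrib_left sum_divide_distrib)
        also have "\<dots> \<le> p / (p + q) * 1 + q / (p + q)"
        proof -
          have "(\<Sum>j\<in>K. norm (F j z) powr (1 / p)) \<le> (\<Sum>j\<in>J. norm (F j z) powr (1 / p))"
            using J K by (intro sum_mono2) auto
          then have "(\<Sum>j\<in>K. norm (F j z) powr (1 / p)) / M \<le> 1" using that by simp
          then show ?thesis using that by (intro add_mono mult_left_mono) auto
        qed
        also have "\<dots> = 1" using that by (simp flip: add_divide_distrib)
        finally show ?thesis .
      qed
      show "(\<Sum>j\<in>K. norm (h j z) powr (1 / (lam + \<mu>))) \<le> 1" if "Re z = \<alpha> \<or> Re z = \<beta>" for z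
        using that
      proof
        assume "Re z = \<alpha>"
        moreover have "Re (G j z) = \<mu> * ln (a j) - lam * ln M0" for j
          using \<open>Re z = \<alpha>\<close> by (simp add: ReG ReW algebra_simps)
        ultimately show ?thesis using young[OF bd0[of z], of \<mu>] lam mu M by (simp add: normh)
      next
        assume "Re z = \<beta>"
        moreover have "Re (G j z) = lam * ln (a j) - \<mu> * ln M1" for j
          using \<open>Re z = \<beta>\<close> ab by (simp add: ReG ReW algebra_simps)
        ultimately show ?thesis using young[OF bd1[of z], of lam] lam mu M
          by (simp add: normh add.commute)
      qed
    qed (use lam mu in auto)
    \<comment> \<open>\<open>R\<close> is the quotient of the two sides of the claim. At
      \<open>z0\<close> every summand is the same power of \<open>R\<close> times
      \<open>a j\<close>, so the whole sum equals \<open>R powr (1 / (lam + \<mu>))\<close>, and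
      this is at most 1.\<close>
    define R where "R = S powr c / (M0 powr (w\<^sub>1 * lam) * M1 powr (w\<^sub>2 * \<mu>))"
    have R: "R > 0" using S M by (simp add: R_def)
    have "norm (h j z0) powr (1 / (lam + \<mu>)) = R powr (1 / (lam + \<mu>)) * a j" if "j \<in> K" for j
    proof -
      have Fz: "norm (F j z0) = exp (c * (ln (a j) + ln S))"
        using that S cpos by (simp add: a_def ln_div ln_powr K_def)
      have "1 - Re (W z0) = w\<^sub>1" "Re (W z0) = w\<^sub>2"
        using ab unfolding ReW w by (auto simp: field_simps)
      then have "Re (G j z0) = (lam + \<mu>) * ln (a j) - c * ln (a j) - (w\<^sub>1 * lam * ln M0 + w\<^sub>2 * \<mu> * ln M1)"
        unfolding ReG c by (simp only:) (simp add: algebra_simps)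
      then have "norm (h j z0) = exp (c * ln S - (w\<^sub>1 * lam * ln M0 + w\<^sub>2 * \<mu> * ln M1) + (lam + \<mu>) * ln (a j))"
        unfolding normh Fz by (simp add: algebra_simps flip: exp_add)
      also have "\<dots> = R * exp ((lam + \<mu>) * ln (a j))"
        using S M by (simp add: R_def powr_def exp_add exp_diff)
      finally show ?thesis using a[OF that] R lam mu
        by (simp add: powr_mult) (simp add: powr_def)
    qed
    then have "R powr (1 / (lam + \<mu>)) \<le> 1"
      using main suma by (simp flip: sum_distrib_left)
    then have "R \<le> 1" using R lam mu
      by (metis add_pos_pos divide_pos_pos linorder_not_le gr_one_powr zero_less_one)
    then show ?thesis using M unfolding R_def S_def by (simp add: divide_le_eq)
  qed
qed

section \<open>The convexity theorem for integrals along vertical lines\<close>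

lemma uniformly_continuous_vanishing_at_infinity:
  fixes \<phi> :: "real \<Rightarrow> real"
  assumes cont: "continuous_on UNIV \<phi>" and lim: "(\<phi> \<longlongrightarrow> 0) at_infinity"
  shows "uniformly_continuous_on UNIV \<phi>"
  unfolding uniformly_continuous_on_def
proof (intro allI impI)
  fix e :: real assume e: "e > 0"
  have "\<forall>\<^sub>F y in at_infinity. norm (\<phi> y) < e / 2"
    using tendstoD[OF lim, of "e / 2"] e by simp
  then obtain b where b: "\<And>y. b \<le> \<bar>y\<bar> \<Longrightarrow> \<bar>\<phi> y\<bar> < e / 2"
    by (auto simp: eventually_at_infinity)
  \<comment> \<open>The margin 1 ensures that if one of two points at distance below 1 lies outside
    the interval, then both lie where \<open>\<bar>\<phi>\<bar> < e / 2\<close>.\<close>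
  have "uniformly_continuous_on {- b - 1..b + 1} \<phi>"
    using cont continuous_on_subset by (intro compact_uniformly_continuous) auto
  from this[unfolded uniformly_continuous_on_def, rule_format, OF e]
  obtain d where d: "d > 0"
    "\<And>y y'. y \<in> {- b - 1..b + 1} \<Longrightarrow> y' \<in> {- b - 1..b + 1} \<Longrightarrow> dist y' y < d \<Longrightarrow> dist (\<phi> y') (\<phi> y) < e"
    by blast
  have "dist (\<phi> y') (\<phi> y) < e" if "dist y' y < min d 1" for y y'
  proof (cases "y \<in> {- b - 1..b + 1} \<and> y' \<in> {- b - 1..b + 1}")
    case True
    then show ?thesis using d(2) that by auto
  next
    case False
    then have "b \<le> \<bar>y\<bar>" "b \<le> \<bar>y'\<bar>" using that by (auto simp: dist_real_def)
    from b[OF this(1)] b[OF this(2)] show ?thesis by (auto simp: dist_real_def)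
  qed
  then show "\<exists>d>0. \<forall>y\<in>UNIV. \<forall>y'\<in>UNIV. dist y' y < d \<longrightarrow> dist (\<phi> y') (\<phi> y) < e"
    using d(1) by (intro exI[of _ "min d 1"]) auto
qed

text \<open>Uniform continuity on the whole line gives a mesh that works for all \<open>t\<close> at
  once. This uniformity is what the three lines theorem asks for, as its boundary bounds concern
  every point of a line.\<close>

lemma riemann_sum_uniform:
  fixes \<phi> :: "real \<Rightarrow> real"
  assumes uc: "uniformly_continuous_on UNIV \<phi>" and L: "L > 0" and e: "e > 0"
  shows "\<forall>\<^sub>F N in sequentially. \<forall>t.
    \<bar>(\<Sum>j<N. L / N * \<phi> (t + j * (L / N))) - integral {t..t + L} \<phi>\<bar> \<le> e"
proof -
  have cont: "continuous_on A \<phi>" for A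
    using uniformly_continuous_imp_continuous[OF uc] continuous_on_subset by blast
  obtain d where d: "d > 0" "\<And>y y'. \<bar>y' - y\<bar> < d \<Longrightarrow> \<bar>\<phi> y' - \<phi> y\<bar> < e / L"
    using uc[unfolded uniformly_continuous_on_def, rule_format, of "e / L"] L e
    by (auto simp: dist_real_def)
  have "(\<lambda>N. L / real N) \<longlonglongrightarrow> 0" by (rule lim_const_over_n)
  then have "\<forall>\<^sub>F N in sequentially. L / real N < d" using d(1) by (rule order_tendstoD)
  then show ?thesis using eventually_gt_at_top[of 0]
  proof eventually_elim
    case (elim N)
    define \<delta> where "\<delta> = L / real N"
    have \<delta>: "\<delta> > 0" "\<delta> < d" "real N * \<delta> = L" using elim L by (auto simp: \<delta>_def)
    show ?case
    proof
      fix t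
      \<comment> \<open>Induction on the number of cells with fixed width \<open>\<delta>\<close>;
        each cell adds an error of at most \<open>\<delta> * (e / L)\<close>, in total
        \<open>e\<close> for \<open>k = N\<close>.\<close>
      have "\<bar>(\<Sum>j<k. \<delta> * \<phi> (t + j * \<delta>)) - integral {t..t + k * \<delta>} \<phi>\<bar> \<le> k * (\<delta> * (e / L))" for k :: nat
      proof (induction k)
        case (Suc k)
        define u where "u = t + k * \<delta>"
        have "integral {t..u + \<delta>} \<phi> = integral {t..u} \<phi> + integral {u..u + \<delta>} \<phi>"
          using \<delta>(1) by (intro Henstock_Kurzweil_Integration.integral_combine[symmetric]
              integrable_continuous_interval cont) (auto simp: u_def)
        moreover have "\<bar>integral {u..u + \<delta>} \<phi> - \<delta> * \<phi> u\<bar> \<le> \<delta> * (e / L)"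
        proof -
          have "norm (integral {u..u + \<delta>} (\<lambda>y. \<phi> y - \<phi> u)) \<le> e / L * (u + \<delta> - u)"
          proof (rule integral_bound)
            show "continuous_on {u..u + \<delta>} (\<lambda>y. \<phi> y - \<phi> u)"
              by (intro continuous_intros cont)
            show "norm (\<phi> y - \<phi> u) \<le> e / L" if "y \<in> {u..u + \<delta>}" for y
              using d(2)[of y u] that \<delta> by auto
          qed (use \<delta> in auto)
          then show ?thesis
            using \<delta>(1) by (subst (asm) integral_diff)
              (auto intro!: integrable_continuous_interval cont simp: mult.commute)
        qed
        ultimately have "\<bar>((\<Sum>j<k. \<delta> * \<phi> (t + j * \<delta>)) + \<delta> * \<phi> u) - integral {t..u + \<delta>} \<phi>\<bar>
            \<le> k * (\<delta> * (e / L)) + \<delta> * (e / L)"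
          using Suc unfolding u_def by linarith
        moreover have "t + Suc k * \<delta> = u + \<delta>" by (simp add: u_def algebra_simps)
        moreover have "Suc k * (\<delta> * (e / L)) = k * (\<delta> * (e / L)) + \<delta> * (e / L)"
          by (simp add: distrib_right add_divide_distrib)
        ultimately show ?case unfolding u_def by (simp only: sum.lessThan_Suc)
      qed simp
      moreover have "real N * (\<delta> * (e / L)) = e"
        unfolding mult.assoc[symmetric] \<delta>(3) using L by simp
      ultimately show "\<bar>(\<Sum>j<N. L / N * \<phi> (t + j * (L / N))) - integral {t..t + L} \<phi>\<bar> \<le> e"
        unfolding \<delta>_def[symmetric] by (metis \<delta>(3))
    qed
  qed
qed

lemma rpow_nonneg: "0 \<le> x rpow a"
  by (simp add: rpow_def)

lemma rpow_mult: "(x * y) rpow a = x rpow a * y rpow a"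
  by (simp add: rpow_def powr_mult)

text \<open>The three lines theorem for sums takes positive bounds, so it is applied with
  \<open>M + e\<close> and \<open>e\<close> tends to 0. For \<open>M = 0\<close>,
  \<open>p = 0\<close> the limit is 1, in accordance with \<open>rpow\<close>.\<close>

lemma tendsto_add_at_right_rpow:
  assumes "M \<ge> 0" "p \<ge> 0"
  shows "((\<lambda>e. (M + e) powr p) \<longlongrightarrow> M rpow p) (at_right 0)"
proof (cases "p = 0")
  case True
  have "\<forall>\<^sub>F e in at_right 0. (M + e) powr p = M rpow p"
    using eventually_at_right_less[of 0] by eventually_elim (use assms True in \<open>auto simp: rpow_def\<close>)
  then show ?thesis by (rule tendsto_eventually)
next
  case False
  have "((\<lambda>e. (M + e) powr p) \<longlongrightarrow> (M + 0) powr p) (at_right 0)"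
  proof (rule tendsto_powr')
    show "((\<lambda>e. M + e) \<longlongrightarrow> M + 0) (at_right 0)" by (intro tendsto_intros)
    have "\<forall>\<^sub>F e in at_right 0. 0 \<le> M + e"
      using eventually_at_right_less[of 0] by eventually_elim (use assms in auto)
    then show "M + 0 \<noteq> 0 \<or> p > 0 \<and> (\<forall>\<^sub>F e in at_right 0. 0 \<le> M + e)"
      using False assms by auto
  qed simp
  then show ?thesis using False by (simp add: rpow_def)
qed

text \<open>A Riemann sum over a window of length \<open>2 * R\<close> is a sum over vertical
  translates of \<open>F\<close>, to which the three lines theorem applies. Moving a point along a
  boundary line moves the window, hence the bounds for all centres \<open>t\<close>.\<close>

lemma three_lines_integral_window:
  fixes F :: "complex \<Rightarrow> complex" and \<alpha> \<beta> lam \<mu> M0 M1 R x :: real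
  assumes ab: "\<alpha> < \<beta>" and lam: "lam > 0" and mu: "\<mu> > 0" and R: "R > 0"
    and hol: "F holomorphic_on {z. \<alpha> < Re z \<and> Re z < \<beta>}"
    and cont: "continuous_on {z. \<alpha> \<le> Re z \<and> Re z \<le> \<beta>} F"
    and lim: "(F \<longlongrightarrow> 0) (inf at_infinity (principal {z. \<alpha> \<le> Re z \<and> Re z \<le> \<beta>}))"
    and bd0: "\<And>t. integral {t - R..t + R} (\<lambda>y. norm (F (Complex \<alpha> y)) powr (1 / lam)) \<le> M0"
    and bd1: "\<And>t. integral {t - R..t + R} (\<lambda>y. norm (F (Complex \<beta> y)) powr (1 / \<mu>)) \<le> M1"
    and x: "\<alpha> \<le> x" "x \<le> \<beta>"
    and w: "w\<^sub>1 = (\<beta> - x) / (\<beta> - \<alpha>)" "w\<^sub>2 = (x - \<alpha>) / (\<beta> - \<alpha>)"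
    and c: "c = w\<^sub>1 * lam + w\<^sub>2 * \<mu>"
  shows "(integral {- R..R} (\<lambda>y. norm (F (Complex x y)) powr (1 / c))) powr c
    \<le> M0 rpow (w\<^sub>1 * lam) * M1 rpow (w\<^sub>2 * \<mu>)"
proof -
  define C where "C = {z. \<alpha> \<le> Re z \<and> Re z \<le> \<beta>}"
  have wn: "w\<^sub>1 \<ge> 0" "w\<^sub>2 \<ge> 0" "w\<^sub>1 + w\<^sub>2 = 1"
    using w x ab by (auto simp flip: add_divide_distrib)
  have cpos: "c > 0"
    using wn lam mu unfolding c by (metis add_nonneg_pos add_pos_nonneg less_eq_real_def
        mult_nonneg_nonneg mult_pos_pos add.right_neutral zero_neq_one)
  have contl: "continuous_on UNIV (\<lambda>y. norm (F (Complex s y)) powr p)" if "s \<in> {\<alpha>..\<beta>}" "p > 0" for s p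
  proof -
    have "continuous_on UNIV (\<lambda>y. F (Complex s y))"
      using that unfolding Complex_eq
      by (intro continuous_on_compose2[OF cont] continuous_intros) auto
    then show ?thesis using that by (intro continuous_on_powr' continuous_intros) auto
  qed
  have uc: "uniformly_continuous_on UNIV (\<lambda>y. norm (F (Complex s y)) powr p)"
    if "s \<in> {\<alpha>..\<beta>}" "p > 0" for s p
  proof (rule uniformly_continuous_vanishing_at_infinity[OF contl[OF that]])
    have "filterlim (\<lambda>y. norm (Complex s y)) at_top at_infinity"
    proof (rule filterlim_at_top_mono)
      show "filterlim (\<lambda>y::real. norm y) at_top at_infinity" by (rule filterlim_norm_at_top)
      show "\<forall>\<^sub>F y in at_infinity. norm y \<le> norm (Complex s y)"
        by (rule always_eventually) (use abs_Im_le_cmod[of "Complex s _"] in simp)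
    qed
    then have "filterlim (Complex s) (inf at_infinity (principal C)) at_infinity"
      using that by (auto simp: filterlim_inf filterlim_principal C_def
          intro: filterlim_norm_at_top_imp_at_infinity)
    then have "((\<lambda>y. F (Complex s y)) \<longlongrightarrow> 0) at_infinity"
      using lim unfolding C_def[symmetric] by (rule filterlim_compose[rotated])
    then have "((\<lambda>y. norm (F (Complex s y)) powr p) \<longlongrightarrow> norm (0::complex) powr p) at_infinity"
      using that by (intro tendsto_powr' tendsto_intros) auto
    then show "((\<lambda>y. norm (F (Complex s y)) powr p) \<longlongrightarrow> 0) at_infinity" by simp
  qed
  define X where "X = integral {- R..R} (\<lambda>y. norm (F (Complex x y)) powr (1 / c))"
  have Xn: "X \<ge> 0" unfolding X_def
    using contl[of x "1 / c"] x cpos continuous_on_subset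
    by (intro integral_nonneg integrable_continuous_interval) auto
  have M0: "M0 \<ge> 0"
  proof -
    have "0 \<le> integral {0 - R..0 + R} (\<lambda>y. norm (F (Complex \<alpha> y)) powr (1 / lam))"
      using contl[of \<alpha> "1 / lam"] ab lam continuous_on_subset
      by (intro integral_nonneg integrable_continuous_interval) auto
    then show ?thesis using bd0[of 0] by simp
  qed
  have M1: "M1 \<ge> 0"
  proof -
    have "0 \<le> integral {0 - R..0 + R} (\<lambda>y. norm (F (Complex \<beta> y)) powr (1 / \<mu>))"
      using contl[of \<beta> "1 / \<mu>"] ab mu continuous_on_subset
      by (intro integral_nonneg integrable_continuous_interval) auto
    then show ?thesis using bd1[of 0] by simp
  qed
  \<comment> \<open>\<open>X - e\<close> is what remains of \<open>X\<close> after the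
    discretization error. The cut at 0 keeps the base in the range where \<open>powr\<close> is
    monotone.\<close>
  have *: "max 0 (X - e) powr c \<le> (M0 + e) powr (w\<^sub>1 * lam) * (M1 + e) powr (w\<^sub>2 * \<mu>)" if e: "e > 0" for e
  proof -
    have "\<forall>\<^sub>F N in sequentially.
      (\<forall>t. \<bar>(\<Sum>j<N. 2 * R / N * norm (F (Complex \<alpha> (t + j * (2 * R / N)))) powr (1 / lam))
        - integral {t..t + 2 * R} (\<lambda>y. norm (F (Complex \<alpha> y)) powr (1 / lam))\<bar> \<le> e) \<and>
      (\<forall>t. \<bar>(\<Sum>j<N. 2 * R / N * norm (F (Complex \<beta> (t + j * (2 * R / N)))) powr (1 / \<mu>))
        - integral {t..t + 2 * R} (\<lambda>y. norm (F (Complex \<beta> y)) powr (1 / \<mu>))\<bar> \<le> e) \<and>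
      (\<forall>t. \<bar>(\<Sum>j<N. 2 * R / N * norm (F (Complex x (t + j * (2 * R / N)))) powr (1 / c))
        - integral {t..t + 2 * R} (\<lambda>y. norm (F (Complex x y)) powr (1 / c))\<bar> \<le> e) \<and> N > 0"
      using ab x lam mu cpos R e
      by (intro eventually_conj riemann_sum_uniform uc eventually_gt_at_top) auto
    from eventually_happens'[OF sequentially_bot this]
    obtain N :: nat where N: "N > 0"
      and N0: "\<forall>t. \<bar>(\<Sum>j<N. 2 * R / N * norm (F (Complex \<alpha> (t + j * (2 * R / N)))) powr (1 / lam))
        - integral {t..t + 2 * R} (\<lambda>y. norm (F (Complex \<alpha> y)) powr (1 / lam))\<bar> \<le> e"
      and N1: "\<forall>t. \<bar>(\<Sum>j<N. 2 * R / N * norm (F (Complex \<beta> (t + j * (2 * R / N)))) powr (1 / \<mu>))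
        - integral {t..t + 2 * R} (\<lambda>y. norm (F (Complex \<beta> y)) powr (1 / \<mu>))\<bar> \<le> e"
      and Nx: "\<forall>t. \<bar>(\<Sum>j<N. 2 * R / N * norm (F (Complex x (t + j * (2 * R / N)))) powr (1 / c))
        - integral {t..t + 2 * R} (\<lambda>y. norm (F (Complex x y)) powr (1 / c))\<bar> \<le> e"
      by (elim exE conjE) (rule that, assumption+)
    define \<delta> where "\<delta> = 2 * R / N"
    have \<delta>: "\<delta> > 0" using N R by (simp add: \<delta>_def)
    \<comment> \<open>The shift by \<open>- R\<close> makes the sample points at \<open>z\<close>
      start at \<open>Im z - R\<close>, so that they fill the window centred at
      \<open>Im z\<close>.\<close>
    define G where "G = (\<lambda>j z. F (z + \<i> * of_real (- R + real j * \<delta>)))"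
    have G: "G j z = F (Complex (Re z) (Im z - R + real j * \<delta>))" for j z
      unfolding G_def by (rule arg_cong[of _ _ F]) (simp add: complex_eq_iff)
    have "(\<Sum>j<N. norm (G j (of_real x)) powr (1 / c)) powr c
      \<le> ((M0 + e) / \<delta>) powr (w\<^sub>1 * lam) * ((M1 + e) / \<delta>) powr (w\<^sub>2 * \<mu>)"
    proof (rule three_lines_sum_norm_powr[where F = G and \<alpha> = \<alpha> and \<beta> = \<beta>])
      show "G j holomorphic_on {z. \<alpha> < Re z \<and> Re z < \<beta>}" for j
        unfolding G_def by (intro holomorphic_on_compose_gen[OF _ hol, unfolded comp_def] holomorphic_intros) auto
      show "continuous_on {z. \<alpha> \<le> Re z \<and> Re z \<le> \<beta>} (G j)" for j
        unfolding G_def by (intro continuous_on_compose2[OF cont] continuous_intros) auto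
      show "(G j \<longlongrightarrow> 0) (inf at_infinity (principal {z. \<alpha> \<le> Re z \<and> Re z \<le> \<beta>}))" for j
        unfolding G_def
      proof (rule filterlim_compose[OF lim])
        let ?s = "\<i> * of_real (- R + real j * \<delta>)"
        have "filterlim (\<lambda>z. z + ?s) at_infinity at_infinity"
          by (rule tendsto_add_filterlim_at_infinity'[OF filterlim_ident tendsto_const])
        then have "filterlim (\<lambda>z. z + ?s) at_infinity (inf at_infinity (principal C))"
          by (rule filterlim_mono) auto
        moreover have "filterlim (\<lambda>z. z + ?s) (principal C) (inf at_infinity (principal C))"
          by (simp add: filterlim_principal eventually_inf_principal C_def)
        ultimately show "filterlim (\<lambda>z. z + ?s) (inf at_infinity (principal {z. \<alpha> \<le> Re z \<and> Re z \<le> \<beta>}))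
            (inf at_infinity (principal {z. \<alpha> \<le> Re z \<and> Re z \<le> \<beta>}))"
          by (simp add: filterlim_inf C_def)
      qed
      show "(\<Sum>j<N. norm (G j z) powr (1 / lam)) \<le> (M0 + e) / \<delta>" if "Re z = \<alpha>" for z
      proof -
        have "\<delta> * (\<Sum>j<N. norm (G j z) powr (1 / lam)) \<le> M0 + e"
          using N0[rule_format, of "Im z - R"] bd0[of "Im z"] that
          by (simp add: G add.commute[of R] sum_distrib_left \<delta>_def[symmetric])
        then show ?thesis using \<delta> by (simp add: field_simps)
      qed
      show "(\<Sum>j<N. norm (G j z) powr (1 / \<mu>)) \<le> (M1 + e) / \<delta>" if "Re z = \<beta>" for z
      proof -
        have "\<delta> * (\<Sum>j<N. norm (G j z) powr (1 / \<mu>)) \<le> M1 + e"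
          using N1[rule_format, of "Im z - R"] bd1[of "Im z"] that
          by (simp add: G add.commute[of R] sum_distrib_left \<delta>_def[symmetric])
        then show ?thesis using \<delta> by (simp add: field_simps)
      qed
    qed (use ab lam mu M0 M1 e \<delta> x w c in auto)
    \<comment> \<open>The powers of \<open>\<delta>\<close> from the two bounds combine to
      \<open>\<delta> powr c\<close> because \<open>c\<close> is the interpolated exponent; this
      turns the sum at \<open>x\<close> into a Riemann sum.\<close>
    also have "\<dots> = (M0 + e) powr (w\<^sub>1 * lam) * (M1 + e) powr (w\<^sub>2 * \<mu>) / \<delta> powr c"
      using M0 M1 e \<delta> by (simp add: powr_divide c powr_add)
    finally have "\<delta> powr c * (\<Sum>j<N. norm (G j (of_real x)) powr (1 / c)) powr c
       \<le> (M0 + e) powr (w\<^sub>1 * lam) * (M1 + e) powr (w\<^sub>2 * \<mu>)"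
      using \<delta> by (simp add: field_simps)
    moreover have "max 0 (X - e) \<le> \<delta> * (\<Sum>j<N. norm (G j (of_real x)) powr (1 / c))"
      using Nx[rule_format, of "- R"] \<delta> by (simp add: G sum_distrib_left \<delta>_def[symmetric] X_def sum_nonneg)
    then have "max 0 (X - e) powr c \<le> (\<delta> * (\<Sum>j<N. norm (G j (of_real x)) powr (1 / c))) powr c"
      using cpos by (intro powr_mono2) auto
    moreover have "\<dots> = \<delta> powr c * (\<Sum>j<N. norm (G j (of_real x)) powr (1 / c)) powr c"
      using \<delta> by (intro powr_mult)
    ultimately show ?thesis by simp
  qed
  have "((\<lambda>e. max 0 (X - e) powr c) \<longlongrightarrow> max 0 (X - 0) powr c) (at_right 0)"
    using cpos by (intro tendsto_powr' tendsto_intros) auto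
  moreover have "((\<lambda>e. (M0 + e) powr (w\<^sub>1 * lam) * (M1 + e) powr (w\<^sub>2 * \<mu>))
      \<longlongrightarrow> M0 rpow (w\<^sub>1 * lam) * M1 rpow (w\<^sub>2 * \<mu>)) (at_right 0)"
    using M0 M1 wn lam mu by (intro tendsto_mult tendsto_add_at_right_rpow) auto
  moreover have "\<forall>\<^sub>F e in at_right 0. max 0 (X - e) powr c \<le> (M0 + e) powr (w\<^sub>1 * lam) * (M1 + e) powr (w\<^sub>2 * \<mu>)"
    using eventually_at_right_less[of 0] by eventually_elim (rule *)
  ultimately have "max 0 (X - 0) powr c \<le> M0 rpow (w\<^sub>1 * lam) * M1 rpow (w\<^sub>2 * \<mu>)"
    by (intro tendsto_le[OF trivial_limit_at_right_real])
  then show ?thesis using Xn by (simp add: X_def)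
qed

section \<open>Gaussian weights\<close>

text \<open>One function expresses oriented Lebesgue integrals, in either order of the end points,
  and gauge integrals as differences. Later estimates thus reduce to derivatives and
  monotonicity.\<close>

lemma continuous_antiderivative:
  fixes g :: "real \<Rightarrow> real"
  assumes "continuous_on UNIV g"
  obtains P where "\<And>y. (P has_real_derivative g y) (at y)" "\<And>s t. (LBINT y=ereal s..ereal t. g y) = P t - P s"
    "\<And>s t. s \<le> t \<Longrightarrow> integral {s..t} g = P t - P s"
proof -
  have "\<exists>P. \<forall>y::real. -\<infinity> < ereal y \<longrightarrow> ereal y < \<infinity> \<longrightarrow> (P has_vector_derivative g y) (at y)"
    using assms by (intro einterval_antiderivative) (auto simp: continuous_on_eq_continuous_at)
  then obtain P where P: "\<And>y. (P has_real_derivative g y) (at y)"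
    by (auto simp: has_real_derivative_iff_has_vector_derivative)
  have *: "(LBINT y=ereal s..ereal t. g y) = P t - P s" for s t
    using P continuous_on_subset[OF assms]
    by (intro interval_integral_FTC_finite)
      (auto simp: has_real_derivative_iff_has_vector_derivative[symmetric] intro: has_field_derivative_at_within)
  have "integral {s..t} g = P t - P s" if "s \<le> t" for s t
    using that P by (intro integral_unique fundamental_theorem_of_calculus)
      (auto simp: has_real_derivative_iff_has_vector_derivative[symmetric] intro: has_field_derivative_at_within)
  with P * show thesis by (rule that)
qed

text \<open>Majorant for the tail integrand below: one factor \<open>exp (- u / 2)\<close> of
  \<open>exp (- u)\<close> absorbs the growth of the inner integrals, the other remains.\<close>

lemma set_integrable_exp_minus_half: "set_integrable lborel {s<..} (\<lambda>u::real. exp (- u / 2))"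
proof -
  have "set_integrable lborel (einterval (ereal s) \<infinity>) (\<lambda>u::real. exp (- u / 2))"
  proof (rule interval_integral_FTC_nonneg(1)[where F = "\<lambda>u. - 2 * exp (- u / 2)"
        and A = "- 2 * exp (- s / 2)" and B = 0])
    have "((\<lambda>u::real. - 2 * exp (- u / 2)) \<longlongrightarrow> - 2 * exp (- s / 2)) (at_right s)"
      by (intro tendsto_intros) auto
    then show "(((\<lambda>u. - 2 * exp (- u / 2)) \<circ> real_of_ereal) \<longlongrightarrow> - 2 * exp (- s / 2)) (at_right (ereal s))"
      by (simp add: ereal_tendsto_simps)
    have "((\<lambda>u::real. - 2 * exp (- u / 2)) \<longlongrightarrow> 0) at_top"
      by real_asymp
    then show "(((\<lambda>u. - 2 * exp (- u / 2)) \<circ> real_of_ereal) \<longlongrightarrow> 0) (at_left \<infinity>)"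
      by (simp add: ereal_tendsto_simps)
  qed (auto intro!: derivative_eq_intros)
  then show ?thesis by (simp add: einterval_def greaterThan_def)
qed

text \<open>Inside \<open>{- b..b}\<close> the weight is at most 1. Outside, integration by parts
  moves the derivative to the weight, and \<open>u = a * y\<^sup>2\<close> turns the result into the
  tail integral. The growth hypothesis removes the boundary term at infinity.\<close>

lemma gaussian_weight_integral_le:
  fixes g :: "real \<Rightarrow> real" and a b L :: real
  assumes cont: "continuous_on UNIV g" and nonneg: "\<And>y. g y \<ge> 0" and a: "a > 0" and b: "b \<ge> 0"
    and lim: "((\<lambda>v. exp (- v\<^sup>2) * (LBINT y=ereal b..ereal (sqrt (2 / a) * v). g y)) \<longlongrightarrow> 0) at_infinity"
  shows "integral {- L..L} (\<lambda>y. g y * exp (- a * y\<^sup>2)) \<le> (LBINT y=ereal (- b)..ereal b. g y) +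
    (LBINT u=ereal (a * b\<^sup>2)..\<infinity>. exp (- u) *
      ((LBINT y=ereal (- sqrt (u / a))..ereal (- b). g y) + (LBINT y=ereal b..ereal (sqrt (u / a)). g y)))"
proof -
  obtain P where P: "\<And>y. (P has_real_derivative g y) (at y)"
    and Pint: "\<And>s t. (LBINT y=ereal s..ereal t. g y) = P t - P s"
    by (rule continuous_antiderivative[OF cont]) (rule that)
  have "continuous_on UNIV (\<lambda>y. g y * exp (- a * y\<^sup>2))"
    by (intro continuous_intros cont)
  then obtain Q where Q: "\<And>y. (Q has_real_derivative g y * exp (- a * y\<^sup>2)) (at y)"
    and Qint: "\<And>s t. s \<le> t \<Longrightarrow> integral {s..t} (\<lambda>y. g y * exp (- a * y\<^sup>2)) = Q t - Q s"
    by (rule continuous_antiderivative) (rule that)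
  have Pcont: "continuous_on UNIV P"
    using P by (intro DERIV_continuous_on[of UNIV P g]) auto
  \<comment> \<open>For \<open>s \<ge> b\<close> this is the integral of \<open>g\<close> over
    \<open>b < \<bar>y\<bar> < s\<close>.\<close>
  define G where "G = (\<lambda>s. P (- b) - P (- s) + (P s - P b))"
  have G: "(LBINT y=ereal (- sqrt (u / a))..ereal (- b). g y) + (LBINT y=ereal b..ereal (sqrt (u / a)). g y) = G (sqrt (u / a))" for u
    unfolding G_def by (simp only: Pint)
  have PQ: "P s \<le> P t" "Q s \<le> Q t" "Q t - P t \<le> Q s - P s" if "s \<le> t" for s t
  proof -
    show "P s \<le> P t" by (rule DERIV_nonneg_imp_nondecreasing[OF that]) (use P nonneg in blast)
    have "0 \<le> g y * exp (- a * y\<^sup>2)" for y using nonneg by simp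
    then show "Q s \<le> Q t" by (intro DERIV_nonneg_imp_nondecreasing[OF that]) (use Q in blast)
    have "((\<lambda>y. Q y - P y) has_real_derivative g y * exp (- a * y\<^sup>2) - g y) (at y)" for y
      by (intro derivative_intros P Q)
    moreover have "g y * exp (- a * y\<^sup>2) - g y \<le> 0" for y
      using nonneg[of y] a by (simp add: mult_left_le)
    ultimately show "Q t - P t \<le> Q s - P s"
      by (intro DERIV_nonpos_imp_nonincreasing[OF that, of "\<lambda>y. Q y - P y"]) blast
  qed
  define \<psi> where "\<psi> = (\<lambda>u. exp (- u) * G (sqrt (u / a)))"
  have \<psi>cont: "continuous_on UNIV \<psi>" unfolding \<psi>_def G_def
    by (intro continuous_intros continuous_on_compose2[OF Pcont]) (use a in auto)
  obtain W where W: "\<And>u. (W has_real_derivative \<psi> u) (at u)"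
    and Wint: "\<And>s t. (LBINT u=ereal s..ereal t. \<psi> u) = W t - W s"
    by (rule continuous_antiderivative[OF \<psi>cont]) (rule that)
  have limG: "((\<lambda>u. exp (- u / 2) * G (sqrt (u / a))) \<longlongrightarrow> 0) at_top"
  proof -
    have lim': "((\<lambda>v. exp (- v\<^sup>2) * (P (sqrt (2 / a) * v) - P b)) \<longlongrightarrow> 0) at_infinity"
      using lim by (simp only: Pint)
    \<comment> \<open>Putting \<open>v = sqrt (u / 2)\<close> and \<open>v = - sqrt (u / 2)\<close>
      in the hypothesis gives the end points \<open>sqrt (u / a)\<close> and
      \<open>- sqrt (u / a)\<close>. Both integrals start at \<open>b\<close>; the correction
      \<open>P (- b) - P b\<close> is a constant times \<open>exp (- u / 2)\<close>.\<close>
    have "filterlim (\<lambda>u::real. sqrt (u / 2)) at_infinity at_top"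
      and "filterlim (\<lambda>u::real. - sqrt (u / 2)) at_infinity at_top"
      by (rule filterlim_at_top_imp_at_infinity filterlim_at_bot_imp_at_infinity, real_asymp)+
    note lims = this[THEN filterlim_compose[OF lim']]
    have lims: "((\<lambda>u. exp (- (sqrt (u / 2))\<^sup>2) * (P (sqrt (2 / a) * sqrt (u / 2)) - P b)) \<longlongrightarrow> 0) at_top"
      "((\<lambda>u. exp (- (- sqrt (u / 2))\<^sup>2) * (P (sqrt (2 / a) * - sqrt (u / 2)) - P b)) \<longlongrightarrow> 0) at_top"
      by (rule lims)+
    have "((\<lambda>u::real. exp (- u / 2)) \<longlongrightarrow> 0) at_top" by real_asymp
    then have "((\<lambda>u. exp (- u / 2) * (P (- b) - P b)) \<longlongrightarrow> 0) at_top"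
      by (rule tendsto_mult_left_zero)
    from tendsto_add[OF tendsto_diff[OF lims] this]
    have "((\<lambda>u. exp (- (sqrt (u / 2))\<^sup>2) * (P (sqrt (2 / a) * sqrt (u / 2)) - P b)
       - exp (- (- sqrt (u / 2))\<^sup>2) * (P (sqrt (2 / a) * - sqrt (u / 2)) - P b)
       + exp (- u / 2) * (P (- b) - P b)) \<longlongrightarrow> 0) at_top" by simp
    moreover have "\<forall>\<^sub>F u in at_top. exp (- (sqrt (u / 2))\<^sup>2) * (P (sqrt (2 / a) * sqrt (u / 2)) - P b)
       - exp (- (- sqrt (u / 2))\<^sup>2) * (P (sqrt (2 / a) * - sqrt (u / 2)) - P b)
       + exp (- u / 2) * (P (- b) - P b) = exp (- u / 2) * G (sqrt (u / a))"
      using eventually_ge_at_top[of 0]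
    proof eventually_elim
      case (elim u)
      have e1: "sqrt (2 / a) * sqrt (u / 2) = sqrt (u / a)"
        by (simp flip: real_sqrt_mult)
      have e2: "(sqrt (u / 2))\<^sup>2 = u / 2" using elim by simp
      show ?case unfolding power2_minus mult_minus_right e1 e2 G_def
        by (simp add: algebra_simps)
    qed
    ultimately show ?thesis by (rule Lim_transform_eventually)
  qed
  have \<psi>nonneg: "0 \<le> \<psi> u" if "u \<ge> a * b\<^sup>2" for u
  proof -
    have "b \<le> sqrt (u / a)" using that a b by (intro real_le_rsqrt) (simp add: field_simps)
    then have "G (sqrt (u / a)) \<ge> 0" using PQ(1)[of b "sqrt (u / a)"] PQ(1)[of "- sqrt (u / a)" "- b"]
      by (simp add: G_def)
    then show ?thesis by (simp add: \<psi>_def)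
  qed
  have \<psi>int: "set_integrable lborel {a * b\<^sup>2<..} \<psi>"
  proof -
    \<comment> \<open>\<open>q\<close> is bounded for \<open>u \<ge> a * b\<^sup>2\<close>, by its
      limit 0 for large \<open>u\<close> and by compactness otherwise; \<open>\<psi>\<close> is
      \<open>q\<close> times the integrable \<open>exp (- u / 2)\<close>.\<close>
    define q where "q = (\<lambda>u. exp (- u / 2) * G (sqrt (u / a)))"
    have "continuous_on UNIV q" unfolding q_def G_def
      by (intro continuous_intros continuous_on_compose2[OF Pcont]) (use a in auto)
    have "\<forall>\<^sub>F u in at_top. norm (q u) < 1"
      using tendstoD[OF limG, of 1] by (simp add: q_def)
    then obtain N where N: "\<And>u. u \<ge> N \<Longrightarrow> norm (q u) < 1"
      by (auto simp: eventually_at_top_linorder)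
    have "compact (q ` {a * b\<^sup>2..N})"
      using \<open>continuous_on UNIV q\<close> continuous_on_subset by (intro compact_continuous_image) auto
    then obtain B where B: "\<And>u. u \<in> {a * b\<^sup>2..N} \<Longrightarrow> norm (q u) \<le> B"
      using compact_imp_bounded by (fastforce simp: bounded_iff)
    have qB: "norm (q u) \<le> max 1 B" if "u \<ge> a * b\<^sup>2" for u
      using N[of u] B[of u] that by force
    show ?thesis
    proof (rule set_integrable_bound)
      show "set_integrable lborel {a * b\<^sup>2<..} (\<lambda>u. max 1 B * exp (- u / 2))"
        by (intro set_integrable_mult_right set_integrable_exp_minus_half)
      show "set_borel_measurable lborel {a * b\<^sup>2<..} \<psi>"
        using \<psi>cont unfolding set_borel_measurable_def
        by (intro borel_measurable_scaleR borel_measurable_indicator)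
          (auto intro: borel_measurable_continuous_onI)
      show "AE u in lborel. u \<in> {a * b\<^sup>2<..} \<longrightarrow> norm (\<psi> u) \<le> norm (max 1 B * exp (- u / 2))"
      proof (intro AE_I2 impI)
        fix u assume "u \<in> {a * b\<^sup>2<..}"
        then have "norm (q u) \<le> max 1 B" using qB by auto
        moreover have "\<psi> u = q u * exp (- u / 2)"
          unfolding \<psi>_def q_def by (simp flip: exp_add)
        ultimately show "norm (\<psi> u) \<le> norm (max 1 B * exp (- u / 2))"
          by (simp add: norm_mult mult_right_mono abs_mult)
      qed
    qed
  qed
  define V where "V = (LBINT u=ereal (a * b\<^sup>2)..\<infinity>. \<psi> u)"
  have WV: "W t - W (a * b\<^sup>2) \<le> V" if "a * b\<^sup>2 \<le> t" for t
  proof -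
    have "W t - W (a * b\<^sup>2) = (LBINT u:{a * b\<^sup>2<..<t}. \<psi> u)"
      using that by (simp add: interval_lebesgue_integral_def flip: Wint)
    also have "\<dots> \<le> (LBINT u:{a * b\<^sup>2<..}. \<psi> u)"
      unfolding set_lebesgue_integral_def using \<psi>int \<psi>nonneg
      by (intro integral_mono') (auto simp: set_integrable_def indicator_def)
    also have "\<dots> = V" by (simp add: V_def interval_integral_to_infinity_eq)
    finally show ?thesis .
  qed
  \<comment> \<open>\<open>D = 0\<close> is integration by parts, without improper integrals.\<close>
  define D where "D = (\<lambda>s. (Q s - Q b) + (Q (- b) - Q (- s)) - (W (a * s\<^sup>2) - W (a * b\<^sup>2)) - G s * exp (- a * s\<^sup>2))"
  have D0: "D s = 0" if "b < s" for s
  proof -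
    \<comment> \<open>For \<open>t > 0\<close> the root of \<open>t\<^sup>2\<close> is
      \<open>t\<close>. The case \<open>b = 0\<close> is covered too, since constancy uses
      derivatives inside the interval and only continuity at its ends.\<close>
    have D': "(D has_real_derivative 0) (at t)" if t: "t > 0" for t
    proof -
      have "(D has_real_derivative (g t * exp (- a * t\<^sup>2) - 0) + (0 - g (- t) * exp (- a * (- t)\<^sup>2) * (- 1))
        - (\<psi> (a * t\<^sup>2) * (a * (2 * t)) - 0)
        - ((0 - g (- t) * (- 1) + (g t - 0)) * exp (- a * t\<^sup>2) + exp (- a * t\<^sup>2) * (- a * (2 * t)) * G t)) (at t)"
        unfolding D_def G_def
        by (rule derivative_eq_intros DERIV_chain2[OF P] DERIV_chain2[OF Q] DERIV_chain2[OF W] refl | simp)+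
      moreover have "sqrt (a * t\<^sup>2 / a) = t" using a t by simp
      ultimately show ?thesis by (simp add: \<psi>_def algebra_simps)
    qed
    have "continuous_on UNIV D"
      unfolding D_def G_def
      by (intro continuous_intros continuous_on_compose2[OF Pcont]
         continuous_on_compose2[OF DERIV_continuous_on[of UNIV Q]] continuous_on_compose2[OF DERIV_continuous_on[of UNIV W]])
        (auto intro: Q W)
    then have "D s = D b"
      using D' b by (intro DERIV_isconst_end[OF that continuous_on_subset]) auto
    then show ?thesis by (simp add: D_def G_def)
  qed
  define Z where "Z = (Q b - Q (- b)) + V"
  have "Q L - Q (- L) \<le> Z"
  proof (rule tendsto_lowerbound)
    have "((\<lambda>u::real. exp (- u / 2)) \<longlongrightarrow> 0) at_top" by real_asymp
    from tendsto_mult[OF this limG]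
    have "((\<lambda>u. exp (- u / 2) * (exp (- u / 2) * G (sqrt (u / a)))) \<longlongrightarrow> 0) at_top" by simp
    moreover have "exp (- u / 2) * (exp (- u / 2) * G (sqrt (u / a))) = G (sqrt (u / a)) * exp (- u)" for u
    proof -
      have "exp (- u) = exp (- u / 2) * exp (- u / 2)" by (simp flip: exp_add)
      then show ?thesis by simp
    qed
    ultimately have "((\<lambda>u. G (sqrt (u / a)) * exp (- u)) \<longlongrightarrow> 0) at_top"
      by (simp only:)
    \<comment> \<open>The limit in \<open>u\<close> is composed with
      \<open>u = a * s\<^sup>2\<close>, so the boundary term \<open>G s\<close> appears as
      \<open>G (sqrt (a * s\<^sup>2 / a))\<close>.\<close>
    moreover have "filterlim (\<lambda>s. a * s\<^sup>2) at_top at_top" using a by real_asymp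
    ultimately have "((\<lambda>s. G (sqrt (a * s\<^sup>2 / a)) * exp (- (a * s\<^sup>2))) \<longlongrightarrow> 0) at_top"
      by (rule filterlim_compose)
    then have "((\<lambda>s. Z + G (sqrt (a * s\<^sup>2 / a)) * exp (- (a * s\<^sup>2))) \<longlongrightarrow> Z + 0) at_top"
      by (intro tendsto_add tendsto_const)
    then show "((\<lambda>s. Z + G (sqrt (a * s\<^sup>2 / a)) * exp (- (a * s\<^sup>2))) \<longlongrightarrow> Z) at_top"
      by simp
    show "\<forall>\<^sub>F s in at_top. Q L - Q (- L) \<le> Z + G (sqrt (a * s\<^sup>2 / a)) * exp (- (a * s\<^sup>2))"
      using eventually_gt_at_top[of b] eventually_gt_at_top[of L]
    proof eventually_elim
      case (elim s)
      have "Q L - Q (- L) \<le> Q s - Q (- s)" using PQ(2)[of L s] PQ(2)[of "- s" "- L"] elim by simp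
      also have "\<dots> = (Q b - Q (- b)) + (W (a * s\<^sup>2) - W (a * b\<^sup>2)) + G s * exp (- a * s\<^sup>2)"
        using D0[of s] elim by (simp add: D_def)
      also have "W (a * s\<^sup>2) - W (a * b\<^sup>2) \<le> V"
        using elim a b by (intro WV mult_left_mono power_mono) auto
      finally show ?case using elim a b by (simp add: Z_def)
    qed
  qed auto
  also have "Z \<le> (P b - P (- b)) + V" using PQ(3)[of "- b" b] b by (simp add: Z_def)
  finally have main: "Q L - Q (- L) \<le> (P b - P (- b)) + V" .
  have "integral {- L..L} (\<lambda>y. g y * exp (- a * y\<^sup>2)) \<le> (P b - P (- b)) + V"
  proof (cases "- L \<le> L")
    case True
    then show ?thesis using main Qint by simp
  next
    \<comment> \<open>The interval is empty and the integral 0, while both terms on the right are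
      nonnegative.\<close>
    case False
    have "V \<ge> 0"
      using WV[OF order_refl] by simp
    moreover have "P (- b) \<le> P b" using b by (intro PQ) auto
    ultimately show ?thesis using False by simp
  qed
  then show ?thesis unfolding G V_def \<psi>_def
    by (simp only: Pint)
qed

section \<open>Removing the pole\<close>

text \<open>For \<open>m > 0\<close> the product agrees near \<open>z\<close> with the holomorphic
  factor \<open>zor_poly f z\<close>; for \<open>m = 0\<close> the limit is part of the
  definition.\<close>

lemma pole_times_power_tendsto:
  assumes pole: "has_pole_of_order f S z m" and S: "open S" "z \<in> S"
    and hol: "f holomorphic_on S - {z}"
  shows "\<exists>l. ((\<lambda>w. f w * (w - z) ^ m) \<longlongrightarrow> l) (at z)"
proof (cases "m = 0")
  case True
  then have "\<exists>l. (f \<longlongrightarrow> l) (at z within S)" using pole by (simp add: has_pole_of_order_def)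
  then show ?thesis unfolding at_within_open[OF S(2,1)] True by simp
next
  case False
  have pl: "is_pole f z" and zo: "zorder f z = - int m"
    using pole[unfolded has_pole_of_order_def if_not_P[OF False]] by blast+
  from zorder_exist_pole[OF hol S pl, unfolded zo]
  obtain r where r: "r > 0" "zor_poly f z holomorphic_on cball z r"
    "\<forall>w\<in>cball z r - {z}. f w = zor_poly f z w / (w - z) ^ nat (- (- int m)) \<and> zor_poly f z w \<noteq> 0"
    by (elim exE conjE) (rule that)
  have "isCont (zor_poly f z) z"
    using holomorphic_on_imp_continuous_on[OF r(2)] r(1)
    by (intro continuous_on_interior[of "cball z r"]) auto
  then have "(zor_poly f z \<longlongrightarrow> zor_poly f z z) (at z)" by (simp add: isCont_def)
  moreover have "\<forall>\<^sub>F w in at z. zor_poly f z w = f w * (w - z) ^ m"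
    using eventually_at_ball'[OF r(1), of z UNIV]
    by eventually_elim (use r(3) in auto)
  ultimately have "((\<lambda>w. f w * (w - z) ^ m) \<longlongrightarrow> zor_poly f z z) (at z)"
    by (rule Lim_transform_eventually)
  then show ?thesis by (rule exI)
qed

text \<open>Riemann's theorem fills in the value at \<open>p\<close>. Continuity on the closed strip
  is glued from two relatively open pieces, the strip without \<open>p\<close> and its interior. If
  \<open>p\<close> lies on a boundary line or outside the strip, \<open>F0\<close> itself
  serves.\<close>

lemma strip_removable_extension:
  fixes F0 :: "complex \<Rightarrow> complex" and \<alpha> \<beta> :: real and p :: complex
  defines "S \<equiv> {z. \<alpha> < Re z \<and> Re z < \<beta>}"
  assumes hol: "F0 holomorphic_on S - {p}"
    and cont: "continuous_on ((S - {p}) \<union> {z. Re z = \<alpha>} \<union> {z. Re z = \<beta>}) F0"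
    and lim: "p \<in> S \<Longrightarrow> \<exists>l. (F0 \<longlongrightarrow> l) (at p)" and ab: "\<alpha> < \<beta>"
  obtains F where "F holomorphic_on S" "continuous_on {z. \<alpha> \<le> Re z \<and> Re z \<le> \<beta>} F"
    "\<And>z. z \<noteq> p \<or> z \<notin> S \<Longrightarrow> F z = F0 z"
proof (cases "p \<in> S")
  case False
  have "(S - {p}) \<union> {z. Re z = \<alpha>} \<union> {z. Re z = \<beta>} = {z. \<alpha> \<le> Re z \<and> Re z \<le> \<beta>}"
    using False ab by (auto simp: S_def)
  with False show thesis using hol cont by (intro that[of F0]) auto
next
  case True
  then obtain l where l: "(F0 \<longlongrightarrow> l) (at p)" using lim by blast
  define C where "C = {z. \<alpha> \<le> Re z \<and> Re z \<le> \<beta>}"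
  define F where "F = (\<lambda>y. if y = p then l else F0 y)"
  have "S = {z. \<alpha> < Re z} \<inter> {z. Re z < \<beta>}" by (auto simp: S_def)
  then have opS: "open S"
    by (simp add: open_halfspace_Re_gt open_halfspace_Re_lt open_Int)
  have F: "F holomorphic_on S" unfolding F_def
    by (rule removable_singularity[OF hol opS l])
  have SC: "S \<subseteq> C" by (auto simp: S_def C_def)
  have un: "(C - {p}) \<union> S = C" using True SC by auto
  have "continuous_on ((C - {p}) \<union> S) F"
  proof (rule continuous_on_Un_local_open)
    show "openin (top_of_set (C - {p} \<union> S)) (C - {p})"
      unfolding un by (auto simp: openin_open intro!: exI[of _ "- {p}"])
    show "openin (top_of_set (C - {p} \<union> S)) S"
      unfolding un using opS SC by (auto simp: openin_open intro!: exI[of _ S])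
    have "C - {p} \<subseteq> (S - {p}) \<union> {z. Re z = \<alpha>} \<union> {z. Re z = \<beta>}" by (auto simp: S_def C_def)
    from continuous_on_subset[OF cont this] show "continuous_on (C - {p}) F"
      by (rule continuous_on_eq) (auto simp: F_def)
    show "continuous_on S F" using F by (rule holomorphic_on_imp_continuous_on)
  qed
  then have "continuous_on C F" by (simp only: un)
  with F show thesis by (intro that[of F]) (use True in \<open>auto simp: C_def F_def\<close>)
qed

section \<open>The weighted convexity estimate\<close>

lemma I_int_nonneg: "s \<le> t \<Longrightarrow> 0 \<le> I_int f x s t c"
  unfolding I_int_def
  by (auto simp: interval_lebesgue_integral_def set_lebesgue_integral_def intro!: Bochner_Integration.integral_nonneg)

text \<open>Monotonicity under a nonnegative integrable majorant; an integrand on the left that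
  fails to be integrable has integral 0 by convention. The bound is asked for only inside the
  interval, since an end point may correspond to 1, where the value of \<open>f\<close> is
  arbitrary.\<close>

lemma I_int_le:
  fixes \<phi> :: "real \<Rightarrow> real"
  assumes "s \<le> t" and cont: "continuous_on UNIV \<phi>" and nonneg: "\<And>y. 0 \<le> \<phi> y"
    and le: "\<And>y. s < y \<Longrightarrow> y < t \<Longrightarrow> norm (f (Complex x y)) powr (1 / c) \<le> \<phi> y"
  shows "I_int f x s t c \<le> integral {s..t} \<phi>"
proof -
  have "set_integrable lborel {s..t} \<phi>"
    using cont continuous_on_subset by (intro borel_integrable_atLeastAtMost') auto
  then have i: "set_integrable lborel {s<..<t} \<phi>"
    by (rule set_integrable_subset) auto
  have "I_int f x s t c = (LBINT y:{s<..<t}. norm (f (Complex x y)) powr (1 / c))"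
    using assms(1) by (simp add: I_int_def interval_lebesgue_integral_def)
  also have "\<dots> \<le> (LBINT y:{s<..<t}. \<phi> y)"
    using i le nonneg unfolding set_lebesgue_integral_def set_integrable_def
    by (intro integral_mono') (auto simp: indicator_def)
  also have "\<dots> = integral {s<..<t} \<phi>" using i by (rule set_borel_integral_eq_integral)
  also have "\<dots> = integral {s..t} \<phi>"
    by (simp add: integral_open_interval_real)
  finally show ?thesis .
qed

text \<open>Every window lies in a symmetric interval \<open>{- L..L}\<close>, over which
  \<open>gaussian_weight_integral_le\<close> gives a bound free of \<open>L\<close>. The result is
  therefore uniform in \<open>t\<close>.\<close>

lemma damped_window_integral_le_J_int:
  fixes f F :: "complex \<Rightarrow> complex" and x T \<kappa> A \<nu> E t R :: real
  assumes cont: "continuous_on {z. Re z = x} f"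
    and decay_int: "\<And>a b c::real. a \<ge> 0 \<Longrightarrow> b > 0 \<Longrightarrow> c > 0 \<Longrightarrow>
                 ((\<lambda>u. exp (- u\<^sup>2) * I_int f x a (b * u) c) \<longlongrightarrow> 0) (at_infinity :: real filter)"
    and T: "T > 0" and \<kappa>: "\<kappa> > 0" and A: "A \<ge> 0" and \<nu>: "\<nu> > 0" and E: "E > 0"
    and le: "\<And>y. norm (F (Complex x y)) \<le> E * exp (- \<kappa> * (y / T)\<^sup>2) * norm (f (Complex x y))"
    and contF: "continuous_on UNIV (\<lambda>y. F (Complex x y))"
  shows "integral {t - R..t + R} (\<lambda>y. norm (F (Complex x y)) powr (1 / \<nu>))
    \<le> E powr (1 / \<nu>) * J_int f T \<kappa> x A \<nu>"
proof -
  \<comment> \<open>The power \<open>1 / \<nu>\<close> of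
    \<open>exp (- \<kappa> * (y / T)\<^sup>2)\<close> is \<open>exp (- a * y\<^sup>2)\<close>. This
    \<open>a\<close> also reproduces the limits of integration in \<open>J_int\<close>.\<close>
  define a where "a = \<kappa> / (\<nu> * T\<^sup>2)"
  have a: "a > 0" using \<kappa> \<nu> T by (simp add: a_def)
  define g where "g = (\<lambda>y. norm (f (Complex x y)) powr (1 / \<nu>))"
  have "continuous_on UNIV (\<lambda>y. f (Complex x y))"
    unfolding Complex_eq by (intro continuous_on_compose2[OF cont] continuous_intros) auto
  then have contg: "continuous_on UNIV g"
    unfolding g_def using \<nu> by (intro continuous_on_powr' continuous_intros) auto
  have gn: "g y \<ge> 0" for y by (simp add: g_def)
  define L where "L = \<bar>t\<bar> + \<bar>R\<bar>"
  define h where "h = (\<lambda>y. norm (F (Complex x y)) powr (1 / \<nu>))"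
  have conth: "continuous_on s h" for s
    using contF \<nu> unfolding h_def
    by (intro continuous_on_powr' continuous_intros continuous_on_subset[OF contF]) auto
  have hle: "h y \<le> E powr (1 / \<nu>) * (g y * exp (- a * y\<^sup>2))" for y
  proof -
    have "h y \<le> (E * exp (- \<kappa> * (y / T)\<^sup>2) * norm (f (Complex x y))) powr (1 / \<nu>)"
      unfolding h_def using \<nu> by (intro powr_mono2 le) auto
    also have "\<dots> = E powr (1 / \<nu>) * (g y * exp (- a * y\<^sup>2))"
      using T \<nu> by (simp add: powr_mult g_def powr_def[of "exp _"] a_def power_divide field_simps)
    finally show ?thesis .
  qed
  have contR: "continuous_on s (\<lambda>y. E powr (1 / \<nu>) * (g y * exp (- a * y\<^sup>2)))" for s
    by (intro continuous_intros continuous_on_subset[OF contg]) auto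
  have "integral {t - R..t + R} h \<le> integral {- L..L} h"
    by (intro integral_subset_le integrable_continuous_interval conth) (auto simp: L_def h_def)
  also have "\<dots> \<le> integral {- L..L} (\<lambda>y. E powr (1 / \<nu>) * (g y * exp (- a * y\<^sup>2)))"
    by (intro integral_le integrable_continuous_interval conth contR hle)
  also have "\<dots> = E powr (1 / \<nu>) * integral {- L..L} (\<lambda>y. g y * exp (- a * y\<^sup>2))"
    by simp
  also have "\<dots> \<le> E powr (1 / \<nu>) * J_int f T \<kappa> x A \<nu>"
  proof (rule mult_left_mono)
    have "integral {- L..L} (\<lambda>y. g y * exp (- a * y\<^sup>2)) \<le> (LBINT y=ereal (- A)..ereal A. g y) +
      (LBINT u=ereal (a * A\<^sup>2)..\<infinity>. exp (- u) *
        ((LBINT y=ereal (- sqrt (u / a))..ereal (- A). g y) + (LBINT y=ereal A..ereal (sqrt (u / a)). g y)))"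
      using decay_int[of A "sqrt (2 / a)" \<nu>] a A \<nu>
      by (intro gaussian_weight_integral_le contg gn) (auto simp: I_int_def g_def)
    also have "\<dots> = J_int f T \<kappa> x A \<nu>"
    proof -
      have "sqrt (u / a) = T * sqrt (\<nu> * u / \<kappa>)" for u
      proof -
        have "u / a = T\<^sup>2 * (\<nu> * u / \<kappa>)" using T \<kappa> \<nu> by (simp add: a_def field_simps)
        then show ?thesis using T by (simp only: real_sqrt_mult) simp
      qed
      moreover have "a * A\<^sup>2 = \<kappa> / \<nu> * (A / T)\<^sup>2" by (simp add: a_def power_divide)
      ultimately show ?thesis by (simp only: J_int_def I_int_def g_def)
    qed
    finally show "integral {- L..L} (\<lambda>y. g y * exp (- a * y\<^sup>2)) \<le> J_int f T \<kappa> x A \<nu>" .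
  qed simp
  finally show ?thesis by (simp add: h_def)
qed

theorem theorem3p2:
  fixes f :: "complex \<Rightarrow> complex"
    and \<alpha> \<beta> T H \<kappa> A\<^sub>1 A\<^sub>2 lam \<mu> x w\<^sub>1 w\<^sub>2 :: real
    and m :: nat
  assumes "1/2 \<le> \<alpha>" and "\<alpha> < \<beta>"
    and holo: "f holomorphic_on {z. \<alpha> < Re z \<and> Re z < \<beta>} - {1}"
    and cont: "continuous_on
                 (({z. \<alpha> < Re z \<and> Re z < \<beta>} - {1}) \<union> {z. Re z = \<alpha>} \<union> {z. Re z = \<beta>}) f"
    and pole: "\<beta> > 1 \<Longrightarrow> has_pole_of_order f {z. \<alpha> < Re z \<and> Re z < \<beta>} 1 m"
    and no_pole: "\<beta> \<le> 1 \<Longrightarrow> m = 0"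
    and decay: "\<And>d::real. d > 0 \<Longrightarrow>
                 uniform_limit {\<alpha>..\<beta>} (\<lambda>y x. exp (- d * y\<^sup>2) * norm (f (Complex x y)))
                   (\<lambda>x. 0) (at_infinity :: real filter)"
    and decay_int: "\<And>x a b c::real. x \<in> {\<alpha>, \<beta>} \<Longrightarrow> a \<ge> 0 \<Longrightarrow> b > 0 \<Longrightarrow> c > 0 \<Longrightarrow>
                 ((\<lambda>u. exp (- u\<^sup>2) * I_int f x a (b * u) c) \<longlongrightarrow> 0) (at_infinity :: real filter)"
    and "T > H" and "H \<ge> 0" and "\<kappa> > 0" and "A\<^sub>1 \<ge> 0" and "A\<^sub>2 \<ge> 0" and "lam > 0" and "\<mu> > 0"
    and "x \<in> {\<alpha>..\<beta>}"
    and "x = 1 \<Longrightarrow> m \<noteq> 0 \<Longrightarrow> H > 0"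
    and w1: "w\<^sub>1 = (\<beta> - x) / (\<beta> - \<alpha>)"
    and w2: "w\<^sub>2 = (x - \<alpha>) / (\<beta> - \<alpha>)"
  shows "(I_int f x (- T) (- H) (w\<^sub>1 * lam + w\<^sub>2 * \<mu>) + I_int f x H T (w\<^sub>1 * lam + w\<^sub>2 * \<mu>))
           rpow (w\<^sub>1 * lam + w\<^sub>2 * \<mu>)
         \<le> (((x - 1)\<^sup>2 + H\<^sup>2) / (x\<^sup>2 + H\<^sup>2)) rpow (- (real m / 2))
           * exp (\<kappa> * (1 + ((\<beta> - \<alpha>) / (2 * T))\<^sup>2))
           * (J_int f T \<kappa> \<alpha> A\<^sub>1 lam) rpow (w\<^sub>1 * lam)
           * (J_int f T \<kappa> \<beta> A\<^sub>2 \<mu>) rpow (w\<^sub>2 * \<mu>)"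
proof -
  note ab = \<open>1/2 \<le> \<alpha>\<close> \<open>\<alpha> < \<beta>\<close>
  have T: "T > 0" using \<open>T > H\<close> \<open>H \<ge> 0\<close> by simp
  have x: "\<alpha> \<le> x" "x \<le> \<beta>" using \<open>x \<in> {\<alpha>..\<beta>}\<close> by auto
  define S where "S = {z. \<alpha> < Re z \<and> Re z < \<beta>}"
  define C where "C = {z. \<alpha> \<le> Re z \<and> Re z \<le> \<beta>}"
  have Cne: "z \<noteq> 0" if "z \<in> C" for z using that ab by (auto simp: C_def)
  have "S = {z. \<alpha> < Re z} \<inter> {z. Re z < \<beta>}" by (auto simp: S_def)
  then have opS: "open S"
    by (simp add: open_halfspace_Re_gt open_halfspace_Re_lt open_Int)
  \<comment> \<open>The Gaussian is centred in the middle of the strip, so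
    \<open>\<bar>Re z - c\<^sub>0\<bar>\<close> is at most \<open>(\<beta> - \<alpha>) / 2\<close>;
    this is the source of \<open>E\<close>.\<close>
  define c\<^sub>0 where "c\<^sub>0 = (\<alpha> + \<beta>) / 2"
  define \<rho> where "\<rho> = (\<lambda>z::complex. ((z - 1) / z) ^ m * exp (of_real (\<kappa> / T\<^sup>2) * (z - of_real c\<^sub>0)\<^sup>2))"
  define \<eta> where "\<eta> = (\<lambda>x y. exp (\<kappa> / T\<^sup>2 * ((x - c\<^sub>0)\<^sup>2 - y\<^sup>2)))"
  have norm\<rho>: "norm (\<rho> z) = norm ((z - 1) / z) ^ m * \<eta> (Re z) (Im z)" for z
    by (simp add: \<rho>_def \<eta>_def norm_mult norm_power power2_eq_square)
  have \<rho>hol: "\<rho> holomorphic_on A" if "A \<subseteq> C" for A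
    unfolding \<rho>_def using that Cne by (intro holomorphic_intros) auto
  define E where "E = exp (\<kappa> * ((\<beta> - \<alpha>) / (2 * T))\<^sup>2)"
  have E: "E > 0" by (simp add: E_def)
  have \<eta>le: "\<eta> s y \<le> E * exp (- \<kappa> * (y / T)\<^sup>2)" if "\<alpha> \<le> s" "s \<le> \<beta>" for s y
  proof -
    have "\<bar>s - c\<^sub>0\<bar> \<le> (\<beta> - \<alpha>) / 2" using that by (auto simp: c\<^sub>0_def field_simps)
    then have "(s - c\<^sub>0)\<^sup>2 \<le> ((\<beta> - \<alpha>) / 2)\<^sup>2" using ab by (subst power2_le_iff_abs_le) auto
    then have "\<kappa> / T\<^sup>2 * ((s - c\<^sub>0)\<^sup>2 - y\<^sup>2) \<le> \<kappa> / T\<^sup>2 * (((\<beta> - \<alpha>) / 2)\<^sup>2 - y\<^sup>2)"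
      using \<open>\<kappa> > 0\<close> by (intro mult_left_mono) auto
    also have "\<dots> = \<kappa> * ((\<beta> - \<alpha>) / (2 * T))\<^sup>2 + - \<kappa> * (y / T)\<^sup>2"
      by (simp add: power_divide power_mult_distrib right_diff_distrib)
    finally show ?thesis unfolding \<eta>_def E_def by (simp flip: exp_add)
  qed
  have \<rho>le: "norm (\<rho> z) \<le> E * exp (- \<kappa> * (Im z / T)\<^sup>2)" if "z \<in> C" for z
  proof -
    \<comment> \<open>Here \<open>1/2 \<le> \<alpha>\<close> enters: points with real part at least
      1/2 are no farther from 1 than from 0.\<close>
    have "(Re z - 1)\<^sup>2 \<le> (Re z)\<^sup>2" using that ab by (simp add: C_def power2_eq_square algebra_simps)
    then have "norm (z - 1) \<le> norm z" by (simp add: cmod_def)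
    then have "norm ((z - 1) / z) ^ m \<le> 1" using Cne[OF that]
      by (intro power_le_one) (auto simp: norm_divide)
    then have "norm (\<rho> z) \<le> \<eta> (Re z) (Im z)" unfolding norm\<rho>
      by (intro mult_left_le_one_le) (auto simp: \<eta>_def)
    also have "\<dots> \<le> E * exp (- \<kappa> * (Im z / T)\<^sup>2)" using that by (intro \<eta>le) (auto simp: C_def)
    finally show ?thesis .
  qed
  have ext1: "(\<lambda>z. f z * \<rho> z) holomorphic_on {z. \<alpha> < Re z \<and> Re z < \<beta>} - {1}"
    by (intro holomorphic_intros holo \<rho>hol) (auto simp: C_def)
  have ext2: "continuous_on (({z. \<alpha> < Re z \<and> Re z < \<beta>} - {1}) \<union> {z. Re z = \<alpha>} \<union> {z. Re z = \<beta>}) (\<lambda>z. f z * \<rho> z)"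
    using ab by (intro continuous_intros cont holomorphic_on_imp_continuous_on[OF \<rho>hol]) (auto simp: C_def)
  have ext3: "\<exists>l. ((\<lambda>z. f z * \<rho> z) \<longlongrightarrow> l) (at 1)" if "1 \<in> {z. \<alpha> < Re z \<and> Re z < \<beta>}"
  proof -
    have one: "1 \<in> S" using that by (simp add: S_def)
    then have "has_pole_of_order f S 1 m" using pole by (simp add: S_def)
    from pole_times_power_tendsto[OF this opS one] holo
    obtain l where "((\<lambda>w. f w * (w - 1) ^ m) \<longlongrightarrow> l) (at 1)" by (auto simp: S_def)
    then have "((\<lambda>w. f w * (w - 1) ^ m * (exp (of_real (\<kappa> / T\<^sup>2) * (w - of_real c\<^sub>0)\<^sup>2) / w ^ m))
      \<longlongrightarrow> l * (exp (of_real (\<kappa> / T\<^sup>2) * (1 - of_real c\<^sub>0)\<^sup>2) / 1 ^ m)) (at 1)"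
      by (intro tendsto_intros) auto
    then show ?thesis unfolding \<rho>_def by (auto simp: power_divide mult.assoc)
  qed
  obtain F where F: "F holomorphic_on S" "continuous_on C F"
    and Feq: "\<And>z. z \<noteq> 1 \<or> z \<notin> S \<Longrightarrow> F z = f z * \<rho> z"
    by (rule strip_removable_extension[OF ext1 ext2 ext3 ab(2), folded S_def C_def]) (assumption, rule that)
  have limF: "(F \<longlongrightarrow> 0) (inf at_infinity (principal C))"
  proof (rule tendstoI)
    fix e :: real assume e: "e > 0"
    have "\<forall>\<^sub>F y in at_infinity. \<forall>s\<in>{\<alpha>..\<beta>}. dist (exp (- (\<kappa> / T\<^sup>2) * y\<^sup>2) * norm (f (Complex s y))) 0 < e / E"
      using decay[of "\<kappa> / T\<^sup>2"] \<open>\<kappa> > 0\<close> T e E by (intro uniform_limitD) auto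
    then obtain b where b: "\<And>y s. b \<le> norm y \<Longrightarrow> s \<in> {\<alpha>..\<beta>} \<Longrightarrow>
        dist (exp (- (\<kappa> / T\<^sup>2) * y\<^sup>2) * norm (f (Complex s y))) 0 < e / E"
      unfolding eventually_at_infinity by blast
    \<comment> \<open>As \<open>\<bar>Re z\<bar> \<le> \<beta>\<close>, the threshold forces
      \<open>\<bar>Im z\<bar> \<ge> b\<close>; the summand 2 also excludes
      \<open>z = 1\<close>.\<close>
    have "dist (F z) 0 < e" if z: "z \<in> C" "norm z \<ge> \<bar>b\<bar> + \<beta> + 2" for z
    proof -
      have "norm z \<le> \<bar>Re z\<bar> + \<bar>Im z\<bar>" by (rule cmod_le)
      then have im: "b \<le> norm (Im z)" using z ab by (auto simp: C_def)
      have "z \<noteq> 1" using z ab by auto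
      then have "norm (F z) = norm (f z) * norm (\<rho> z)" by (simp add: Feq norm_mult)
      also have "\<dots> \<le> norm (f z) * (E * exp (- \<kappa> * (Im z / T)\<^sup>2))"
        using z by (intro mult_left_mono \<rho>le) auto
      also have "\<dots> = E * (exp (- (\<kappa> / T\<^sup>2) * (Im z)\<^sup>2) * norm (f (Complex (Re z) (Im z))))"
        by (simp add: power_divide)
      also have "\<dots> < E * (e / E)"
        using b[OF im, of "Re z"] z E by (intro mult_strict_left_mono) (auto simp: C_def)
      finally show ?thesis using E by simp
    qed
    then show "\<forall>\<^sub>F z in inf at_infinity (principal C). dist (F z) 0 < e"
      by (auto simp: eventually_inf_principal eventually_at_infinity)
  qed
  have contline: "continuous_on UNIV (\<lambda>y. F (Complex s y))" if "\<alpha> \<le> s" "s \<le> \<beta>" for s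
    using that unfolding Complex_eq
    by (intro continuous_on_compose2[OF F(2)] continuous_intros) (auto simp: C_def)
  \<comment> \<open>Points on the boundary lines lie outside \<open>S\<close>, so there
    \<open>F\<close> is the product of \<open>f\<close> and \<open>\<rho>\<close>. The half-width
    \<open>T\<close> gives the interval \<open>{- T..T}\<close> on the line
    \<open>Re z = x\<close>.\<close>
  have bound: "integral {t - T..t + T} (\<lambda>y. norm (F (Complex s y)) powr (1 / \<nu>))
      \<le> E powr (1 / \<nu>) * J_int f T \<kappa> s A \<nu>"
    if s: "s \<in> {\<alpha>, \<beta>}" and "A \<ge> 0" "\<nu> > 0" for s A \<nu> t
  proof (rule damped_window_integral_le_J_int[OF _ _ T \<open>\<kappa> > 0\<close> that(2,3) E])
    show "continuous_on {z. Re z = s} f"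
      using s by (intro continuous_on_subset[OF cont]) auto
    show "continuous_on UNIV (\<lambda>y. F (Complex s y))" using s ab by (intro contline) auto
    show "norm (F (Complex s y)) \<le> E * exp (- \<kappa> * (y / T)\<^sup>2) * norm (f (Complex s y))" for y
    proof -
      have "Complex s y \<notin> S" "Complex s y \<in> C" using s ab by (auto simp: S_def C_def)
      then show ?thesis using \<rho>le[of "Complex s y"]
        by (simp add: Feq norm_mult mult.commute[of "norm (f _)"] mult_right_mono)
    qed
    show "((\<lambda>u. exp (- u\<^sup>2) * I_int f s a (b * u) c) \<longlongrightarrow> 0) at_infinity" if "a \<ge> 0" "b > 0" "c > 0" for a b c
      using s that by (rule decay_int)
  qed
  define c where "c = w\<^sub>1 * lam + w\<^sub>2 * \<mu>"
  have wn: "w\<^sub>1 \<ge> 0" "w\<^sub>2 \<ge> 0" "w\<^sub>1 + w\<^sub>2 = 1"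
    using w1 w2 x ab by (auto simp flip: add_divide_distrib)
  have cpos: "c > 0"
    using wn \<open>lam > 0\<close> \<open>\<mu> > 0\<close> unfolding c_def by (metis add_nonneg_pos add_pos_nonneg less_eq_real_def
        mult_nonneg_nonneg mult_pos_pos add.right_neutral zero_neq_one)
  define X where "X = integral {- T..T} (\<lambda>y. norm (F (Complex x y)) powr (1 / c))"
  have "X powr c \<le> (E powr (1 / lam) * J_int f T \<kappa> \<alpha> A\<^sub>1 lam) rpow (w\<^sub>1 * lam)
      * (E powr (1 / \<mu>) * J_int f T \<kappa> \<beta> A\<^sub>2 \<mu>) rpow (w\<^sub>2 * \<mu>)"
    unfolding X_def
    by (rule three_lines_integral_window[OF ab(2) \<open>lam > 0\<close> \<open>\<mu> > 0\<close> T F[unfolded S_def C_def]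
        limF[unfolded C_def] _ _ x w1 w2 c_def])
      (auto intro: bound \<open>A\<^sub>1 \<ge> 0\<close> \<open>A\<^sub>2 \<ge> 0\<close> \<open>lam > 0\<close> \<open>\<mu> > 0\<close>)
  also have "\<dots> = ((E powr (1 / lam)) rpow (w\<^sub>1 * lam) * (E powr (1 / \<mu>)) rpow (w\<^sub>2 * \<mu>)) *
      ((J_int f T \<kappa> \<alpha> A\<^sub>1 lam) rpow (w\<^sub>1 * lam) * (J_int f T \<kappa> \<beta> A\<^sub>2 \<mu>) rpow (w\<^sub>2 * \<mu>))"
    by (simp add: rpow_mult)
  \<comment> \<open>The exponents reduce to \<open>w\<^sub>1\<close> and \<open>w\<^sub>2\<close>,
    whose sum is 1.\<close>
  also have "(E powr (1 / lam)) rpow (w\<^sub>1 * lam) * (E powr (1 / \<mu>)) rpow (w\<^sub>2 * \<mu>) = E"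
  proof -
    have "(E powr (1 / lam)) rpow (w\<^sub>1 * lam) = E powr w\<^sub>1" "(E powr (1 / \<mu>)) rpow (w\<^sub>2 * \<mu>) = E powr w\<^sub>2"
      using E \<open>lam > 0\<close> \<open>\<mu> > 0\<close> by (auto simp: rpow_def powr_powr)
    then show ?thesis using wn E by (simp flip: powr_add)
  qed
  finally have main: "X powr c \<le> E *
      ((J_int f T \<kappa> \<alpha> A\<^sub>1 lam) rpow (w\<^sub>1 * lam) * (J_int f T \<kappa> \<beta> A\<^sub>2 \<mu>) rpow (w\<^sub>2 * \<mu>))" .
  define q where "q = ((x - 1)\<^sup>2 + H\<^sup>2) / (x\<^sup>2 + H\<^sup>2)"
  \<comment> \<open>\<open>q\<close> is the squared modulus of \<open>(z - 1) / z\<close> at height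
    \<open>H\<close>. The two factors of \<open>K\<close> undo the smallest values of the two
    factors of \<open>\<rho>\<close>.\<close>
  define K where "K = q rpow (- (real m / 2)) * exp \<kappa>"
  have Kn: "K \<ge> 0" by (simp add: K_def rpow_nonneg)
  have fle: "norm (f (Complex x y)) \<le> K * norm (F (Complex x y))" if y: "H < \<bar>y\<bar>" "\<bar>y\<bar> < T" for y
  proof -
    have y0: "y \<noteq> 0" using y \<open>H \<ge> 0\<close> by auto
    then have "Complex x y \<noteq> 1" by (simp add: complex_eq_iff)
    then have Fy: "norm (F (Complex x y)) = norm (f (Complex x y)) * norm (\<rho> (Complex x y))"
      by (simp add: Feq norm_mult)
    have y2: "H\<^sup>2 \<le> y\<^sup>2" "y\<^sup>2 \<le> T\<^sup>2"
      using y \<open>H \<ge> 0\<close> T by (auto simp: abs_le_square_iff[symmetric])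
    have "1 \<le> q rpow (- (real m / 2)) * norm ((Complex x y - 1) / Complex x y) ^ m"
    proof (cases "m = 0")
      case False
      have x0: "x > 0" using x ab by simp
      \<comment> \<open>The numerator could vanish only for \<open>x = 1\<close> and
        \<open>H = 0\<close>, which is ruled out for \<open>m \<noteq> 0\<close>.\<close>
      have "q > 0"
        using False x0 \<open>x = 1 \<Longrightarrow> m \<noteq> 0 \<Longrightarrow> H > 0\<close> unfolding q_def
        by (intro divide_pos_pos; simp add: sum_power2_gt_zero_iff; fastforce)
      define n where "n = norm ((Complex x y - 1) / Complex x y)"
      have n2: "n\<^sup>2 = ((x - 1)\<^sup>2 + y\<^sup>2) / (x\<^sup>2 + y\<^sup>2)"
        by (simp add: n_def norm_divide power_divide cmod_power2)
      have "q \<le> n\<^sup>2"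
      proof -
        have "(x - 1)\<^sup>2 \<le> x\<^sup>2" using x ab by (simp add: power2_eq_square algebra_simps)
        \<comment> \<open>This product is the difference of the two cross-multiplied sides of
          \<open>q \<le> n\<^sup>2\<close>.\<close>
        then have "(x\<^sup>2 - (x - 1)\<^sup>2) * (y\<^sup>2 - H\<^sup>2) \<ge> 0" using y2 by simp
        then have "((x - 1)\<^sup>2 + H\<^sup>2) * (x\<^sup>2 + y\<^sup>2) \<le> ((x - 1)\<^sup>2 + y\<^sup>2) * (x\<^sup>2 + H\<^sup>2)"
          by (simp add: algebra_simps)
        moreover have "x\<^sup>2 + H\<^sup>2 > 0" "x\<^sup>2 + y\<^sup>2 > 0" using x0 by (auto intro: add_pos_nonneg)
        ultimately show ?thesis unfolding q_def n2 by (intro frac_le_eq[THEN iffD2]) (auto simp: divide_simps)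
      qed
      then have "q powr (real m / 2) \<le> (n\<^sup>2) powr (real m / 2)"
        using \<open>q > 0\<close> by (intro powr_mono2) auto
      also have "\<dots> = n ^ m"
      proof -
        have "n \<noteq> 0" using \<open>q \<le> n\<^sup>2\<close> \<open>q > 0\<close> by auto
        then have n: "n > 0" by (simp add: n_def)
        then have "(n\<^sup>2) powr (real m / 2) = (n powr 2) powr (real m / 2)" by simp
        also have "\<dots> = n powr real m" unfolding powr_powr by simp
        also have "\<dots> = n ^ m" using n by (rule powr_realpow)
        finally show ?thesis .
      qed
      finally show ?thesis using \<open>q > 0\<close> False
        by (simp add: rpow_def powr_minus divide_simps n_def[symmetric])
    qed (simp add: rpow_def)
    \<comment> \<open>For \<open>\<bar>y\<bar> < T\<close> the Gaussian factor has modulus at least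
      \<open>exp (- \<kappa>)\<close>, since \<open>(x - c\<^sub>0)\<^sup>2\<close> only increases
      it.\<close>
    moreover have "1 \<le> exp \<kappa> * \<eta> x y"
    proof -
      have "0 \<le> \<kappa> / T\<^sup>2 * ((x - c\<^sub>0)\<^sup>2 + (T\<^sup>2 - y\<^sup>2))" using y2 \<open>\<kappa> > 0\<close> by simp
      also have "\<dots> = \<kappa> + \<kappa> / T\<^sup>2 * ((x - c\<^sub>0)\<^sup>2 - y\<^sup>2)" using T by (simp add: field_simps)
      finally show ?thesis by (simp add: \<eta>_def flip: exp_add)
    qed
    ultimately have "1 * 1 \<le> (q rpow (- (real m / 2)) * norm ((Complex x y - 1) / Complex x y) ^ m) * (exp \<kappa> * \<eta> x y)"
      by (intro mult_mono) auto
    also have "\<dots> = K * norm (\<rho> (Complex x y))" by (simp add: norm\<rho> K_def)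
    finally have "norm (f (Complex x y)) * 1 \<le> norm (f (Complex x y)) * (K * norm (\<rho> (Complex x y)))"
      by (intro mult_left_mono) auto
    then show ?thesis unfolding Fy by (simp add: mult_ac)
  qed
  define \<phi> where "\<phi> = (\<lambda>y. K powr (1 / c) * norm (F (Complex x y)) powr (1 / c))"
  have \<phi>cont: "continuous_on A \<phi>" for A unfolding \<phi>_def using cpos
    by (intro continuous_intros continuous_on_powr' continuous_on_subset[OF contline[OF x]]) auto
  have \<phi>n: "0 \<le> \<phi> y" for y by (simp add: \<phi>_def)
  have f\<phi>: "norm (f (Complex x y)) powr (1 / c) \<le> \<phi> y" if "H < \<bar>y\<bar>" "\<bar>y\<bar> < T" for y
    using powr_mono2[OF _ _ fle[OF that], of "1 / c"] cpos by (simp add: \<phi>_def powr_mult)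
  have "I_int f x (- T) (- H) c \<le> integral {- T..- H} \<phi>"
    using \<open>H \<ge> 0\<close> \<open>T > H\<close> by (intro I_int_le \<phi>cont \<phi>n f\<phi>) auto
  moreover have "I_int f x H T c \<le> integral {H..T} \<phi>"
    using \<open>H \<ge> 0\<close> \<open>T > H\<close> by (intro I_int_le \<phi>cont \<phi>n f\<phi>) auto
  moreover have "integral {- T..- H} \<phi> + integral {H..T} \<phi> \<le> integral {- T..T} \<phi>"
  proof -
    have "integral {- T..T} \<phi> = integral {- T..- H} \<phi> + integral {- H..T} \<phi>"
      using \<open>H \<ge> 0\<close> \<open>T > H\<close>
      by (intro Henstock_Kurzweil_Integration.integral_combine[symmetric] integrable_continuous_interval \<phi>cont) auto
    moreover have "integral {H..T} \<phi> \<le> integral {- H..T} \<phi>"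
      using \<open>H \<ge> 0\<close> by (intro integral_subset_le integrable_continuous_interval \<phi>cont) (auto intro: \<phi>n)
    ultimately show ?thesis by simp
  qed
  moreover have "integral {- T..T} \<phi> = K powr (1 / c) * X" by (simp add: \<phi>_def X_def)
  ultimately have "I_int f x (- T) (- H) c + I_int f x H T c \<le> K powr (1 / c) * X" by simp
  then have "(I_int f x (- T) (- H) c + I_int f x H T c) rpow c \<le> (K powr (1 / c) * X) powr c"
    using cpos I_int_nonneg[of "- T" "- H" f x c] I_int_nonneg[of H T f x c] \<open>T > H\<close>
    by (simp add: rpow_def powr_mono2)
  also have "\<dots> = K * X powr c" using cpos Kn by (simp add: powr_mult powr_powr)
  also have "\<dots> \<le> K * (E *
      ((J_int f T \<kappa> \<alpha> A\<^sub>1 lam) rpow (w\<^sub>1 * lam) * (J_int f T \<kappa> \<beta> A\<^sub>2 \<mu>) rpow (w\<^sub>2 * \<mu>)))"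
    using main Kn by (rule mult_left_mono)
  also have "\<dots> = q rpow (- (real m / 2)) * (exp \<kappa> * E) *
      (J_int f T \<kappa> \<alpha> A\<^sub>1 lam) rpow (w\<^sub>1 * lam) * (J_int f T \<kappa> \<beta> A\<^sub>2 \<mu>) rpow (w\<^sub>2 * \<mu>)"
    by (simp add: K_def)
  also have "exp \<kappa> * E = exp (\<kappa> * (1 + ((\<beta> - \<alpha>) / (2 * T))\<^sup>2))"
    by (simp add: E_def distrib_left flip: exp_add)
  finally show ?thesis unfolding c_def q_def .
qed

end
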